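(* Let $K$ be a compact convex subset of a locally convex vector space and let $\mu,\nu\in M^+(K)$. Then $\mu\prec_c\nu$ implies that $\mu\prec_d\nu$.
   Context: $\mathrm{C}(K)$ is the C*-algebra of continuous complex-valued functions on $K$, $A(K)\subset\mathrm{C}(K)$ is the space of continuous affine functions, and $M^+(K)$ is the set of (finite) positive regular Borel measures on $K$. Choquet order: $\mu\prec_c\nu$ if $\int f\,d\mu\le\int f\,d\nu$ for every continuous convex (real-valued) function $f$ on $K$. Dilation order: a representation of $\mu\in M^+(K)$ is a tuple $(\pi,H,\xi)$ with $\pi:\mathrm{C}(K)\to\mathcal{B}(H)$ a $*$-representation on a Hilbert space $H$ and $\xi\in H$ such that $\int_K f\,d\mu=\langle\pi(f)\xi,\xi\rangle$ for all $f\in\mathrm{C}(K)$. A representation $(\pi,H,\xi)$ of $\mu$ is dilated by a representation $(\sigma,L,\eta)$ of $\nu$ if there is an isometry $V:H\to L$ with $\pi(a)=V^*\sigma(a)V$ for all $a\in A(K)$ and $\eta=V\xi$. Then $\mu\prec_d\nu$ if some representation of $\mu$ is dilated by a representation of $\nu$. *)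

theory Defs
  imports "HOL-Analysis.Analysis"
begin

(* Real locally convex Hausdorff topological vector spaces. A complex locally convex
   space is one by restriction of scalars; convexity only involves real scalars. The
   constant "convex" is not available inside a class declaration, so it is unfolded. *)
class locally_convex_space = topological_ab_group_add + real_vector + t2_space +
  assumes tendsto_scaleR_Pair:
    "((\<lambda>p. fst p *\<^sub>R snd p) \<longlongrightarrow> r *\<^sub>R x) (nhds r \<times>\<^sub>F nhds x)"
  and convex_neighbourhood:
    "open U \<Longrightarrow> x \<in> U \<Longrightarrow> \<exists>C. open C \<and> x \<in> C \<and> C \<subseteq> U \<and>
      (\<forall>y\<in>C. \<forall>z\<in>C. \<forall>u\<ge>0. \<forall>v\<ge>0. u + v = 1 \<longrightarrow> u *\<^sub>R y + v *\<^sub>R z \<in> C)"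

text \<open>
  Functions on \<open>K\<close> are represented by functions on the whole space that vanish outside
  \<open>K\<close>. This makes the representing function unique, the operations of \<open>C(K)\<close> pointwise,
  and \<open>indicator K\<close> the unit.
\<close>

definition CK :: "'a::topological_space set \<Rightarrow> ('a \<Rightarrow> complex) set" where
  "CK K = {f. continuous_on K f \<and> (\<forall>x. x \<notin> K \<longrightarrow> f x = 0)}"

definition AK :: "'a::{topological_space,real_vector} set \<Rightarrow> ('a \<Rightarrow> complex) set" where
  "AK K = {a \<in> CK K. \<forall>x\<in>K. \<forall>y\<in>K. \<forall>t\<in>{0..1}.
     a ((1 - t) *\<^sub>R x + t *\<^sub>R y) = (1 - t) *\<^sub>R a x + t *\<^sub>R a y}"

definition Mplus :: "'a::topological_space set \<Rightarrow> 'a measure set" where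
  "Mplus K = {\<mu>. sets \<mu> = sets (restrict_space borel K) \<and> finite_measure \<mu> \<and>
     (\<forall>A\<in>sets \<mu>.
        emeasure \<mu> A = (SUP C\<in>{C. compact C \<and> C \<subseteq> A}. emeasure \<mu> C) \<and>
        emeasure \<mu> A = (INF U\<in>{U. open U \<and> A \<subseteq> U}. emeasure \<mu> (U \<inter> K)))}"

definition choquet_le ::
  "'a::{topological_space,real_vector} set \<Rightarrow> 'a measure \<Rightarrow> 'a measure \<Rightarrow> bool" where
  "choquet_le K \<mu> \<nu> \<longleftrightarrow>
     (\<forall>f::'a \<Rightarrow> real. continuous_on K f \<and> convex_on K f \<longrightarrow>
        integral\<^sup>L \<mu> f \<le> integral\<^sup>L \<nu> f)"

text \<open>
  Complex Hilbert spaces are structures on a carrier set, because the dilation order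
  quantifies existentially over Hilbert spaces.
\<close>

record 'h hspace =
  hcarrier :: "'h set"
  hzero :: 'h
  hadd :: "'h \<Rightarrow> 'h \<Rightarrow> 'h"
  hscale :: "complex \<Rightarrow> 'h \<Rightarrow> 'h"
  hinner :: "'h \<Rightarrow> 'h \<Rightarrow> complex"

definition hnorm :: "'h hspace \<Rightarrow> 'h \<Rightarrow> real" where
  "hnorm H x = sqrt (Re (hinner H x x))"

definition hdist :: "'h hspace \<Rightarrow> 'h \<Rightarrow> 'h \<Rightarrow> real" where
  "hdist H x y = hnorm H (hadd H x (hscale H (-1) y))"

(* The inner product is linear in its first argument. *)
locale hilbert_space =
  fixes H :: "'h hspace"
  assumes zero_closed: "hzero H \<in> hcarrier H"
    and add_closed: "\<lbrakk>x \<in> hcarrier H; y \<in> hcarrier H\<rbrakk> \<Longrightarrow> hadd H x y \<in> hcarrier H"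
    and scale_closed: "x \<in> hcarrier H \<Longrightarrow> hscale H c x \<in> hcarrier H"
    and add_assoc: "\<lbrakk>x \<in> hcarrier H; y \<in> hcarrier H; z \<in> hcarrier H\<rbrakk> \<Longrightarrow>
      hadd H (hadd H x y) z = hadd H x (hadd H y z)"
    and add_commute: "\<lbrakk>x \<in> hcarrier H; y \<in> hcarrier H\<rbrakk> \<Longrightarrow> hadd H x y = hadd H y x"
    and zero_add: "x \<in> hcarrier H \<Longrightarrow> hadd H (hzero H) x = x"
    and add_inverse: "x \<in> hcarrier H \<Longrightarrow> hadd H x (hscale H (-1) x) = hzero H"
    and scale_add: "\<lbrakk>x \<in> hcarrier H; y \<in> hcarrier H\<rbrakk> \<Longrightarrow>
      hscale H c (hadd H x y) = hadd H (hscale H c x) (hscale H c y)"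
    and add_scale: "x \<in> hcarrier H \<Longrightarrow>
      hscale H (c + d) x = hadd H (hscale H c x) (hscale H d x)"
    and scale_scale: "x \<in> hcarrier H \<Longrightarrow> hscale H c (hscale H d x) = hscale H (c * d) x"
    and one_scale: "x \<in> hcarrier H \<Longrightarrow> hscale H 1 x = x"
    and inner_add: "\<lbrakk>x \<in> hcarrier H; y \<in> hcarrier H; z \<in> hcarrier H\<rbrakk> \<Longrightarrow>
      hinner H (hadd H x y) z = hinner H x z + hinner H y z"
    and inner_scale: "\<lbrakk>x \<in> hcarrier H; y \<in> hcarrier H\<rbrakk> \<Longrightarrow>
      hinner H (hscale H c x) y = c * hinner H x y"
    and inner_commute: "\<lbrakk>x \<in> hcarrier H; y \<in> hcarrier H\<rbrakk> \<Longrightarrow>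
      hinner H x y = cnj (hinner H y x)"
    and inner_nonneg: "x \<in> hcarrier H \<Longrightarrow> 0 \<le> Re (hinner H x x)"
    and inner_definite: "\<lbrakk>x \<in> hcarrier H; hinner H x x = 0\<rbrakk> \<Longrightarrow> x = hzero H"
    and complete: "Metric_space.mcomplete (hcarrier H) (hdist H)"

definition hlinear :: "'h hspace \<Rightarrow> 'l hspace \<Rightarrow> ('h \<Rightarrow> 'l) \<Rightarrow> bool" where
  "hlinear H L T \<longleftrightarrow>
     (\<forall>x\<in>hcarrier H. T x \<in> hcarrier L) \<and>
     (\<forall>x\<in>hcarrier H. \<forall>y\<in>hcarrier H. T (hadd H x y) = hadd L (T x) (T y)) \<and>
     (\<forall>c. \<forall>x\<in>hcarrier H. T (hscale H c x) = hscale L c (T x))"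

definition hbounded :: "'h hspace \<Rightarrow> 'l hspace \<Rightarrow> ('h \<Rightarrow> 'l) \<Rightarrow> bool" where
  "hbounded H L T \<longleftrightarrow>
     hlinear H L T \<and> (\<exists>B. \<forall>x\<in>hcarrier H. hnorm L (T x) \<le> B * hnorm H x)"

definition hisometry :: "'h hspace \<Rightarrow> 'l hspace \<Rightarrow> ('h \<Rightarrow> 'l) \<Rightarrow> bool" where
  "hisometry H L V \<longleftrightarrow>
     hlinear H L V \<and> (\<forall>x\<in>hcarrier H. hnorm L (V x) = hnorm H x)"

definition hadjoint :: "'h hspace \<Rightarrow> 'l hspace \<Rightarrow> ('h \<Rightarrow> 'l) \<Rightarrow> 'l \<Rightarrow> 'h" where
  "hadjoint H L T y =
     (THE z. z \<in> hcarrier H \<and> (\<forall>x\<in>hcarrier H. hinner L (T x) y = hinner H x z))"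

(* Unital *-homomorphisms from C(K) to B(H). Operators are compared on the carrier only. *)
definition star_representation ::
  "'a::topological_space set \<Rightarrow> 'h hspace \<Rightarrow> (('a \<Rightarrow> complex) \<Rightarrow> 'h \<Rightarrow> 'h) \<Rightarrow> bool" where
  "star_representation K H \<pi> \<longleftrightarrow>
     (\<forall>f\<in>CK K. hbounded H H (\<pi> f)) \<and>
     (\<forall>f\<in>CK K. \<forall>g\<in>CK K. \<forall>x\<in>hcarrier H.
        \<pi> (\<lambda>k. f k + g k) x = hadd H (\<pi> f x) (\<pi> g x)) \<and>
     (\<forall>c. \<forall>f\<in>CK K. \<forall>x\<in>hcarrier H. \<pi> (\<lambda>k. c * f k) x = hscale H c (\<pi> f x)) \<and>
     (\<forall>f\<in>CK K. \<forall>g\<in>CK K. \<forall>x\<in>hcarrier H. \<pi> (\<lambda>k. f k * g k) x = \<pi> f (\<pi> g x)) \<and>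
     (\<forall>f\<in>CK K. \<forall>x\<in>hcarrier H. \<pi> (\<lambda>k. cnj (f k)) x = hadjoint H H (\<pi> f) x) \<and>
     (\<forall>x\<in>hcarrier H. \<pi> (indicator K) x = x)"

definition measure_representation ::
  "'a::topological_space set \<Rightarrow> 'a measure \<Rightarrow>
     (('a \<Rightarrow> complex) \<Rightarrow> 'h \<Rightarrow> 'h) \<Rightarrow> 'h hspace \<Rightarrow> 'h \<Rightarrow> bool" where
  "measure_representation K \<mu> \<pi> H \<xi> \<longleftrightarrow>
     hilbert_space H \<and> star_representation K H \<pi> \<and> \<xi> \<in> hcarrier H \<and>
     (\<forall>f\<in>CK K. integral\<^sup>L \<mu> f = hinner H (\<pi> f \<xi>) \<xi>)"

definition dilated_by ::
  "'a::{topological_space,real_vector} set \<Rightarrow>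
     (('a \<Rightarrow> complex) \<Rightarrow> 'h \<Rightarrow> 'h) \<Rightarrow> 'h hspace \<Rightarrow> 'h \<Rightarrow>
     (('a \<Rightarrow> complex) \<Rightarrow> 'l \<Rightarrow> 'l) \<Rightarrow> 'l hspace \<Rightarrow> 'l \<Rightarrow> bool" where
  "dilated_by K \<pi> H \<xi> \<sigma> L \<eta> \<longleftrightarrow>
     (\<exists>V. hisometry H L V \<and>
        (\<forall>a\<in>AK K. \<forall>x\<in>hcarrier H. \<pi> a x = hadjoint H L V (\<sigma> a (V x))) \<and>
        \<eta> = V \<xi>)"

text \<open>
  The elements of the Hilbert spaces are taken from one type, since HOL cannot quantify over
  types inside a formula. The type is large enough for this to be no restriction: given a
  dilation \<open>V : H \<rightarrow> L\<close> on arbitrary Hilbert spaces, one may replace \<open>H\<close> by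
  \<open>H\<^sub>0\<close>, the closure of \<open>\<pi>(C(K))\<xi>\<close>, and \<open>L\<close> by the closed span of
  \<open>\<sigma>(C(K))V H\<^sub>0\<close>. These have at most as many elements as there are sequences in the
  type \<open>'a \<Rightarrow> complex\<close>, which is the cardinality of \<open>'a \<Rightarrow> complex\<close> itself.
\<close>

definition dilation_le ::
  "'a::{topological_space,real_vector} set \<Rightarrow> 'a measure \<Rightarrow> 'a measure \<Rightarrow> bool" where
  "dilation_le K \<mu> \<nu> \<longleftrightarrow>
     (\<exists>\<pi> (H :: (('a \<Rightarrow> complex) \<Rightarrow> complex) hspace) \<xi>
       \<sigma> (L :: (('a \<Rightarrow> complex) \<Rightarrow> complex) hspace) \<eta>.
        measure_representation K \<mu> \<pi> H \<xi> \<and> measure_representation K \<nu> \<sigma> L \<eta> \<and>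
        dilated_by K \<pi> H \<xi> \<sigma> L \<eta>)"

end

theory Submission
  imports Defs
begin

text \<open>
  The measures are coupled by a positive functional \<open>\<theta>\<close> on functions on \<open>K \<times> K\<close>, and both
  representations live in the Hilbert space of \<open>\<theta>\<close>.

  Suppose that \<open>\<theta>\<close> satisfies \<open>\<theta>(d) = \<integral> d(x,x) d\<mu>(x)\<close> whenever \<open>d\<close> is continuous and affine in its
  second variable, and \<open>\<theta>(f(y)) = \<integral> f d\<nu>\<close> for continuous \<open>f\<close>. Form the Hilbert space \<open>L\<close> of the
  semi-inner product \<open>\<theta>(F \<cdot> cnj G)\<close>, let \<open>C(K)\<close> act on it by multiplication with functions of \<open>y\<close>,
  and take the constant function \<open>1\<close> as vector: this represents \<open>\<nu>\<close>. In the closure \<open>H\<close> of the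
  functions of \<open>x\<close>, let \<open>C(K)\<close> act by multiplication with functions of \<open>x\<close>; the same vector then
  represents \<open>\<mu>\<close>. For \<open>a \<in> A(K)\<close> and \<open>g, h \<in> C(K)\<close> the function \<open>g(x) cnj(a(y) h(x))\<close> is
  affine in \<open>y\<close>, so its value under \<open>\<theta>\<close> does not change if \<open>a(y)\<close> becomes \<open>a(x)\<close>. This says that
  the compression of \<open>a(y)\<close> to \<open>H\<close> is \<open>a(x)\<close>, so the inclusion \<open>H \<subseteq> L\<close> is the required isometry.

  The two prescriptions for \<open>\<theta>\<close> extend to a positive functional by the Hahn--Banach theorem
  (\<open>hahn_banach_sublinear\<close>) as soon as \<open>0 \<le> d(x,y) + f(y)\<close> on \<open>K \<times> K\<close> implies
  \<open>0 \<le> \<integral> d(x,x) d\<mu> + \<integral> f d\<nu>\<close>. This is where the Choquet order enters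
  (\<open>choquet_le_positivity\<close>): the function \<open>\<phi>(y) = sup\<^sub>x -d(x,y)\<close> is convex and continuous, and
  \<open>-d(x,x) \<le> \<phi>(x)\<close> and \<open>\<phi> \<le> f\<close>.

  A vector of a completion is recorded as the functional that it induces on the space being
  completed (\<open>represents\<close>), so that no quotient has to be formed. The functions on \<open>K \<times> K\<close> are
  moved to functions on the single space \<open>'a\<close> by a bijection \<open>'a \<cong> 'a \<times> 'a\<close> (\<open>ex_bij_prod\<close>), so that
  these functionals have the type \<open>('a \<Rightarrow> complex) \<Rightarrow> complex\<close>.
\<close>

section \<open>Sublinear functionals and the Hahn--Banach theorem\<close>

definition function_subspace :: "('z \<Rightarrow> 'c::semiring_1) set \<Rightarrow> bool" where
  "function_subspace S \<longleftrightarrow> (\<lambda>z. 0) \<in> S \<and>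
     (\<forall>F\<in>S. \<forall>G\<in>S. (\<lambda>z. F z + G z) \<in> S) \<and> (\<forall>c. \<forall>F\<in>S. (\<lambda>z. c * F z) \<in> S)"

lemma function_subspaceD:
  assumes "function_subspace S"
  shows "(\<lambda>z. 0) \<in> S" "F \<in> S \<Longrightarrow> G \<in> S \<Longrightarrow> (\<lambda>z. F z + G z) \<in> S"
    "F \<in> S \<Longrightarrow> (\<lambda>z. c * F z) \<in> S"
  using assms by (auto simp: function_subspace_def)

lemma function_subspace_uminus:
  fixes S :: "('z \<Rightarrow> 'c::ring_1) set"
  assumes "function_subspace S" "F \<in> S"
  shows "(\<lambda>z. - F z) \<in> S"
  using function_subspaceD(3)[OF assms(1,2), of "-1"] by simp

lemma function_subspace_diff:
  fixes S :: "('z \<Rightarrow> 'c::ring_1) set"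
  assumes "function_subspace S" "F \<in> S" "G \<in> S"
  shows "(\<lambda>z. F z - G z) \<in> S"
  using function_subspaceD(2)[OF assms(1,2) function_subspace_uminus[OF assms(1,3)]] by simp

definition sublinear_on :: "('z \<Rightarrow> real) set \<Rightarrow> (('z \<Rightarrow> real) \<Rightarrow> real) \<Rightarrow> bool" where
  "sublinear_on S p \<longleftrightarrow>
     (\<forall>F\<in>S. \<forall>G\<in>S. p (\<lambda>z. F z + G z) \<le> p F + p G) \<and>
     (\<forall>c>0. \<forall>F\<in>S. p (\<lambda>z. c * F z) \<le> c * p F)"

definition linear_functional_on :: "('z \<Rightarrow> 'c::semiring_1) set \<Rightarrow> (('z \<Rightarrow> 'c) \<Rightarrow> 'c) \<Rightarrow> bool" where
  "linear_functional_on S l \<longleftrightarrow>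
     (\<forall>F\<in>S. \<forall>G\<in>S. l (\<lambda>z. F z + G z) = l F + l G) \<and>
     (\<forall>c. \<forall>F\<in>S. l (\<lambda>z. c * F z) = c * l F)"

lemma sublinear_onD:
  assumes "sublinear_on S p"
  shows "F \<in> S \<Longrightarrow> G \<in> S \<Longrightarrow> p (\<lambda>z. F z + G z) \<le> p F + p G"
    "c > 0 \<Longrightarrow> F \<in> S \<Longrightarrow> p (\<lambda>z. c * F z) \<le> c * p F"
  using assms by (auto simp: sublinear_on_def)

lemma sublinear_on_scale_eq:
  assumes S: "function_subspace S" and p: "sublinear_on S p" and "c > 0" "F \<in> S"
  shows "p (\<lambda>z. c * F z) = c * p F"
proof (rule antisym)
  show "p (\<lambda>z. c * F z) \<le> c * p F"
    using sublinear_onD(2)[OF p] assms by blast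
  have "p (\<lambda>z. inverse c * (c * F z)) \<le> inverse c * p (\<lambda>z. c * F z)"
    by (rule sublinear_onD(2)[OF p]) (use assms function_subspaceD(3)[OF S] in auto)
  moreover have "(\<lambda>z. inverse c * (c * F z)) = F"
    using \<open>c > 0\<close> by (simp add: fun_eq_iff)
  ultimately have "p F \<le> inverse c * p (\<lambda>z. c * F z)" by simp
  then have "c * p F \<le> c * (inverse c * p (\<lambda>z. c * F z))"
    using \<open>c > 0\<close> mult_le_cancel_left_pos by blast
  then show "c * p F \<le> p (\<lambda>z. c * F z)"
    using \<open>c > 0\<close> by (simp flip: mult.assoc)
qed

lemma sublinear_on_zero:
  assumes S: "function_subspace S" and p: "sublinear_on S p"
  shows "p (\<lambda>z. 0) = 0"
  using sublinear_on_scale_eq[OF S p, of 2 "\<lambda>z. 0"] function_subspaceD(1)[OF S] by simp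

lemma sublinear_on_uminus:
  assumes S: "function_subspace S" and p: "sublinear_on S p" and "F \<in> S"
  shows "- p (\<lambda>z. - F z) \<le> p F"
  using sublinear_onD(1)[OF p \<open>F \<in> S\<close> function_subspace_uminus[OF S \<open>F \<in> S\<close>]]
    sublinear_on_zero[OF S p] by simp

text \<open>An infimum of sublinear functionals need not be subadditive. Along a chain it is: for \<open>q\<close> and
  \<open>r\<close> in the chain the smaller one, \<open>t\<close>, gives \<open>t (F + G) \<le> t F + t G \<le> q F + r G\<close>.\<close>

lemma sublinear_on_Inf_chain:
  assumes S: "function_subspace S" and "C \<noteq> {}"
    and sub: "\<And>q. q \<in> C \<Longrightarrow> sublinear_on S q"
    and bdd: "\<And>q F. q \<in> C \<Longrightarrow> F \<in> S \<Longrightarrow> b F \<le> q F"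
    and chain: "\<And>q r. q \<in> C \<Longrightarrow> r \<in> C \<Longrightarrow> (\<forall>F\<in>S. q F \<le> r F) \<or> (\<forall>F\<in>S. r F \<le> q F)"
  shows "sublinear_on S (\<lambda>F. INF q\<in>C. q F)"
proof -
  have bb: "bdd_below ((\<lambda>q. q F) ` C)" if "F \<in> S" for F
    using bdd that by (auto intro!: bdd_belowI[of _ "b F"])
  have low: "(INF q\<in>C. q F) \<le> q F" if "q \<in> C" "F \<in> S" for q F
    using bb that by (auto intro: cINF_lower)
  show ?thesis
    unfolding sublinear_on_def
  proof (intro conjI ballI allI impI)
    fix F G assume FG: "F \<in> S" "G \<in> S"
    have *: "(INF q\<in>C. q (\<lambda>z. F z + G z)) \<le> q F + r G" if qr: "q \<in> C" "r \<in> C" for q r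
    proof -
      have "\<exists>t\<in>C. t F \<le> q F \<and> t G \<le> r G"
        using chain[OF qr]
      proof
        assume "\<forall>F\<in>S. q F \<le> r F"
        then show ?thesis using qr FG by (intro bexI[of _ q]) auto
      next
        assume "\<forall>F\<in>S. r F \<le> q F"
        then show ?thesis using qr FG by (intro bexI[of _ r]) auto
      qed
      then obtain t where t: "t \<in> C" "t F \<le> q F" "t G \<le> r G" by blast
      have "(INF q\<in>C. q (\<lambda>z. F z + G z)) \<le> t (\<lambda>z. F z + G z)"
        using low t function_subspaceD(2)[OF S] FG by blast
      also have "\<dots> \<le> t F + t G" using sublinear_onD(1)[OF sub] t FG by blast
      finally show ?thesis using t by linarith
    qed
    have "(INF q\<in>C. q (\<lambda>z. F z + G z)) - r G \<le> (INF q\<in>C. q F)" if "r \<in> C" for r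
      using * that \<open>C \<noteq> {}\<close> by (intro cINF_greatest) (auto simp: algebra_simps)
    then have "(INF q\<in>C. q (\<lambda>z. F z + G z)) - (INF q\<in>C. q F) \<le> (INF q\<in>C. q G)"
      using \<open>C \<noteq> {}\<close> by (intro cINF_greatest) (auto simp: algebra_simps)
    then show "(INF q\<in>C. q (\<lambda>z. F z + G z)) \<le> (INF q\<in>C. q F) + (INF q\<in>C. q G)"
      by linarith
  next
    fix c :: real and F assume c: "c > 0" and F: "F \<in> S"
    have "(INF q\<in>C. q (\<lambda>z. c * F z)) \<le> c * q F" if "q \<in> C" for q
      using low[OF that function_subspaceD(3)[OF S F]] sublinear_onD(2)[OF sub[OF that] c F]
      by (rule order_trans)
    then have "(INF q\<in>C. q (\<lambda>z. c * F z)) / c \<le> (INF q\<in>C. q F)"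
      using \<open>C \<noteq> {}\<close> c by (intro cINF_greatest) (auto simp: field_simps)
    then show "(INF q\<in>C. q (\<lambda>z. c * F z)) \<le> c * (INF q\<in>C. q F)"
      using c by (simp add: field_simps)
  qed
qed

text \<open>Zorn's lemma applies since \<open>-p(-F)\<close> is a lower bound at \<open>F\<close> for all sublinear functionals
  below \<open>p\<close>, so the infimum over a chain of them is finite.\<close>

lemma exists_minimal_sublinear:
  assumes S: "function_subspace S" and p: "sublinear_on S p"
  obtains m where "sublinear_on S m" "\<And>F. F \<in> S \<Longrightarrow> m F \<le> p F"
    "\<And>q F. sublinear_on S q \<Longrightarrow> (\<And>G. G \<in> S \<Longrightarrow> q G \<le> m G) \<Longrightarrow> F \<in> S \<Longrightarrow> q F = m F"
proof -
  \<comment> \<open>The value \<open>0\<close> off \<open>S\<close> makes the pointwise order antisymmetric.\<close>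
  define A where "A = {q. sublinear_on S q \<and> (\<forall>F\<in>S. q F \<le> p F) \<and> (\<forall>F. F \<notin> S \<longrightarrow> q F = 0)}"
  define P where "P = (\<lambda>q r :: ('a \<Rightarrow> real) \<Rightarrow> real. \<forall>F. r F \<le> q F)"
  have cong: "sublinear_on S (\<lambda>F. if F \<in> S then q F else 0)" if "sublinear_on S q" for q
    using that function_subspaceD[OF S] by (auto simp: sublinear_on_def)
  have po: "partial_order_on A (relation_of P A)"
    unfolding partial_order_on_def preorder_on_def refl_on_def trans_def antisym_def
      relation_of_def P_def
    by (auto intro: order_trans) (metis antisym ext)
  have ch: "\<exists>u\<in>A. \<forall>a\<in>C. P a u" if C: "C \<in> Chains (relation_of P A)" for C
  proof (cases "C = {}")
    case True
    have "(\<lambda>F. if F \<in> S then p F else 0) \<in> A"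
      using cong[OF p] by (auto simp: A_def)
    with True show ?thesis by auto
  next
    case False
    have CA: "q \<in> A" if "q \<in> C" for q
      using C that by (auto simp: Chains_def relation_of_def)
    have cc: "(\<forall>F. q F \<le> r F) \<or> (\<forall>F. r F \<le> q F)" if "q \<in> C" "r \<in> C" for q r
      using C that by (auto simp: Chains_def relation_of_def P_def)
    have bd: "- p (\<lambda>z. - F z) \<le> q F" if "q \<in> C" "F \<in> S" for q F
    proof -
      have "q (\<lambda>z. - F z) \<le> p (\<lambda>z. - F z)"
        using CA[OF that(1)] function_subspace_uminus[OF S that(2)] by (auto simp: A_def)
      moreover have "- q (\<lambda>z. - F z) \<le> q F"
        using CA[OF that(1)] sublinear_on_uminus[OF S _ that(2)] by (auto simp: A_def)
      ultimately show ?thesis by linarith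
    qed
    define u where "u = (\<lambda>F. if F \<in> S then (INF q\<in>C. q F) else 0)"
    have "sublinear_on S (\<lambda>F. INF q\<in>C. q F)"
    proof (rule sublinear_on_Inf_chain[OF S False, where b = "\<lambda>F. - p (\<lambda>z. - F z)"])
      show "sublinear_on S q" if "q \<in> C" for q using CA[OF that] by (simp add: A_def)
      show "- p (\<lambda>z. - F z) \<le> q F" if "q \<in> C" "F \<in> S" for q F by (rule bd[OF that])
      show "(\<forall>F\<in>S. q F \<le> r F) \<or> (\<forall>F\<in>S. r F \<le> q F)" if "q \<in> C" "r \<in> C" for q r
        using cc[OF that] by blast
    qed
    then have "sublinear_on S u" unfolding u_def by (rule cong)
    moreover have le: "u F \<le> q F" if "q \<in> C" for q F
    proof (cases "F \<in> S")
      case True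
      then have "bdd_below ((\<lambda>q. q F) ` C)"
        using bd by (auto intro!: bdd_belowI[of _ "- p (\<lambda>z. - F z)"])
      then show ?thesis using that True by (auto simp: u_def intro: cINF_lower)
    next
      case F: False
      then show ?thesis using CA[OF that] by (auto simp: u_def A_def)
    qed
    moreover have "u F \<le> p F" if "F \<in> S" for F
    proof -
      obtain q where "q \<in> C" using False by blast
      then show ?thesis using le[of q F] CA[of q] that by (force simp: A_def)
    qed
    ultimately have "u \<in> A" by (auto simp: A_def u_def)
    then show ?thesis using le by (auto simp: P_def)
  qed
  obtain m where m: "m \<in> A" and min: "\<And>q. q \<in> A \<Longrightarrow> P m q \<Longrightarrow> q = m"
    using predicate_Zorn[OF po ch] by blast
  show thesis
  proof
    show "sublinear_on S m" "\<And>F. F \<in> S \<Longrightarrow> m F \<le> p F" using m by (auto simp: A_def)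
    fix q F assume q: "sublinear_on S q" "\<And>G. G \<in> S \<Longrightarrow> q G \<le> m G" and F: "F \<in> S"
    let ?q = "\<lambda>F. if F \<in> S then q F else 0"
    have "?q \<in> A" using cong[OF q(1)] q(2) m by (force simp: A_def)
    moreover have "P m ?q" using q(2) m by (auto simp: A_def P_def)
    ultimately have "?q = m" by (rule min)
    from fun_cong[OF this, of F] show "q F = m F" using F by simp
  qed
qed

text \<open>Fix \<open>G\<close>. The functional \<open>F \<mapsto> inf\<^sub>t\<^sub>\<ge>\<^sub>0 (m (F + tG) - t m G)\<close> is again sublinear and, by
  \<open>t = 0\<close>, lies below \<open>m\<close>; by minimality it is \<open>m\<close>. Taking \<open>t = 1\<close> gives
  \<open>m F + m G \<le> m (F + G)\<close>, the reverse of subadditivity.\<close>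

lemma minimal_sublinear_is_linear:
  assumes S: "function_subspace S" and m: "sublinear_on S m"
    and min: "\<And>q F. sublinear_on S q \<Longrightarrow> (\<And>G. G \<in> S \<Longrightarrow> q G \<le> m G) \<Longrightarrow> F \<in> S \<Longrightarrow> q F = m F"
  shows "linear_functional_on S m"
proof -
  have m0: "m (\<lambda>z. 0) = 0" by (rule sublinear_on_zero[OF S m])
  have scale: "m (\<lambda>z. t * G z) = t * m G" if "t \<ge> 0" "G \<in> S" for t G
    using sublinear_on_scale_eq[OF S m _ that(2), of t] m0 that(1) by (cases "t = 0") auto
  have add_le: "m F + m G \<le> m (\<lambda>z. F z + G z)" if F: "F \<in> S" and G: "G \<in> S" for F G
  proof -
    define q where "q = (\<lambda>F. INF t\<in>{0..}. m (\<lambda>z. F z + t * G z) - t * m G)"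
    have inS: "(\<lambda>z. F z + t * G z) \<in> S" if "F \<in> S" for F t
      using that G function_subspaceD[OF S] by blast
    have lb: "- m (\<lambda>z. - F z) \<le> m (\<lambda>z. F z + t * G z) - t * m G" if "F \<in> S" "t \<ge> 0" for F t
    proof -
      have "m (\<lambda>z. (F z + t * G z) + - F z) \<le> m (\<lambda>z. F z + t * G z) + m (\<lambda>z. - F z)"
        by (rule sublinear_onD(1)[OF m inS[OF that(1)] function_subspace_uminus[OF S that(1)]])
      moreover have "(\<lambda>z. (F z + t * G z) + - F z) = (\<lambda>z. t * G z)" by (simp add: fun_eq_iff)
      ultimately show ?thesis using scale[OF that(2) G] by simp
    qed
    have low: "q F \<le> m (\<lambda>z. F z + t * G z) - t * m G" if "F \<in> S" "t \<ge> 0" for F t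
      unfolding q_def using lb that
      by (intro cINF_lower bdd_belowI2[where m = "- m (\<lambda>z. - F z)"]) auto
    have great: "x \<le> q F" if "\<And>t. t \<ge> 0 \<Longrightarrow> x \<le> m (\<lambda>z. F z + t * G z) - t * m G" for F x
      unfolding q_def using that by (intro cINF_greatest) auto
    have "sublinear_on S q"
      unfolding sublinear_on_def
    proof (intro conjI ballI allI impI)
      fix E F assume EF: "E \<in> S" "F \<in> S"
      have *: "q (\<lambda>z. E z + F z) \<le> (m (\<lambda>z. E z + t * G z) - t * m G) + (m (\<lambda>z. F z + u * G z) - u * m G)"
        if "t \<ge> 0" "u \<ge> 0" for t u
      proof -
        have "q (\<lambda>z. E z + F z) \<le> m (\<lambda>z. (E z + F z) + (t + u) * G z) - (t + u) * m G"
          using low[OF function_subspaceD(2)[OF S EF]] that by simp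
        also have "(\<lambda>z. (E z + F z) + (t + u) * G z) = (\<lambda>z. (E z + t * G z) + (F z + u * G z))"
          by (simp add: fun_eq_iff algebra_simps)
        also have "m \<dots> \<le> m (\<lambda>z. E z + t * G z) + m (\<lambda>z. F z + u * G z)"
          by (rule sublinear_onD(1)[OF m inS inS]) (use EF in auto)
        finally show ?thesis by (simp add: algebra_simps)
      qed
      have "q (\<lambda>z. E z + F z) - (m (\<lambda>z. F z + u * G z) - u * m G) \<le> q E" if "u \<ge> 0" for u
        by (rule great) (use *[OF _ that] in \<open>simp add: algebra_simps\<close>)
      then have "q (\<lambda>z. E z + F z) - q E \<le> q F"
        by (intro great) (simp add: algebra_simps)
      then show "q (\<lambda>z. E z + F z) \<le> q E + q F" by linarith
    next
      fix c :: real and F assume c: "c > 0" and F: "F \<in> S"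
      have "q (\<lambda>z. c * F z) / c \<le> m (\<lambda>z. F z + t * G z) - t * m G" if "t \<ge> 0" for t
      proof -
        have "q (\<lambda>z. c * F z) \<le> m (\<lambda>z. c * F z + (c * t) * G z) - (c * t) * m G"
          using low[OF function_subspaceD(3)[OF S F]] that c by simp
        also have "(\<lambda>z. c * F z + (c * t) * G z) = (\<lambda>z. c * (F z + t * G z))"
          by (simp add: fun_eq_iff algebra_simps)
        also have "m \<dots> = c * m (\<lambda>z. F z + t * G z)"
          by (rule sublinear_on_scale_eq[OF S m c inS[OF F]])
        finally have "q (\<lambda>z. c * F z) \<le> c * (m (\<lambda>z. F z + t * G z) - t * m G)"
          by (simp add: algebra_simps)
        then show ?thesis using c by (simp add: divide_le_eq mult.commute)
      qed
      then have "q (\<lambda>z. c * F z) / c \<le> q F" by (rule great)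
      then show "q (\<lambda>z. c * F z) \<le> c * q F" using c by (simp add: divide_le_eq mult.commute)
    qed
    moreover have "q F \<le> m F" if "F \<in> S" for F
      using low[OF that, of 0] by simp
    ultimately have "q F = m F" using min F by blast
    then show ?thesis using low[OF F, of 1] by simp
  qed
  have add: "m (\<lambda>z. F z + G z) = m F + m G" if "F \<in> S" "G \<in> S" for F G
    using add_le[OF that] sublinear_onD(1)[OF m that] by linarith
  have neg: "m (\<lambda>z. - F z) = - m F" if "F \<in> S" for F
    using add[OF that function_subspace_uminus[OF S that]] m0 by simp
  have "m (\<lambda>z. c * F z) = c * m F" if "F \<in> S" for c F
  proof (cases "c \<ge> 0")
    case True
    then show ?thesis using scale that by blast
  next
    case False
    then show ?thesis
      using neg[OF function_subspaceD(3)[OF S that, of "- c"]] scale[OF _ that, of "- c"] by simp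
  qed
  with add show ?thesis by (auto simp: linear_functional_on_def)
qed

theorem hahn_banach_sublinear:
  assumes "function_subspace S" "sublinear_on S p"
  obtains l where "linear_functional_on S l" "\<And>F. F \<in> S \<Longrightarrow> l F \<le> p F"
  using exists_minimal_sublinear[OF assms] minimal_sublinear_is_linear[OF assms(1)] by metis

section \<open>Completing a semi-inner product on a space of functions\<close>

text \<open>The form may be degenerate. Vectors are functions with pointwise operations, rather than
  elements of an abstract vector space, because a Hilbert space in the sense of \<open>hspace\<close> is built
  from functionals on them whose type has to be \<open>('a \<Rightarrow> complex) \<Rightarrow> complex\<close> in the end.\<close>

locale semi_inner_functions =
  fixes X :: "('z \<Rightarrow> complex) set" and s :: "('z \<Rightarrow> complex) \<Rightarrow> ('z \<Rightarrow> complex) \<Rightarrow> complex"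
  assumes X: "function_subspace X"
    and s_add_left: "\<lbrakk>x \<in> X; y \<in> X; w \<in> X\<rbrakk> \<Longrightarrow> s (\<lambda>z. x z + y z) w = s x w + s y w"
    and s_scale_left: "\<lbrakk>x \<in> X; w \<in> X\<rbrakk> \<Longrightarrow> s (\<lambda>z. c * x z) w = c * s x w"
    and s_commute: "\<lbrakk>x \<in> X; y \<in> X\<rbrakk> \<Longrightarrow> s x y = cnj (s y x)"
    and s_nonneg: "x \<in> X \<Longrightarrow> 0 \<le> Re (s x x)"
begin

lemma X_closed [simp, intro]:
  "(\<lambda>z. 0) \<in> X" "x \<in> X \<Longrightarrow> y \<in> X \<Longrightarrow> (\<lambda>z. x z + y z) \<in> X" "x \<in> X \<Longrightarrow> (\<lambda>z. c * x z) \<in> X"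
  "x \<in> X \<Longrightarrow> y \<in> X \<Longrightarrow> (\<lambda>z. x z - y z) \<in> X" "x \<in> X \<Longrightarrow> (\<lambda>z. - x z) \<in> X"
  using function_subspaceD[OF X] function_subspace_diff[OF X] function_subspace_uminus[OF X] by auto

lemma s_diff_left: "\<lbrakk>x \<in> X; y \<in> X; w \<in> X\<rbrakk> \<Longrightarrow> s (\<lambda>z. x z - y z) w = s x w - s y w"
  using s_add_left[of x "\<lambda>z. (-1) * y z" w] s_scale_left[of y w "-1"] by simp

lemma s_add_right: "\<lbrakk>x \<in> X; y \<in> X; w \<in> X\<rbrakk> \<Longrightarrow> s w (\<lambda>z. x z + y z) = s w x + s w y"
  by (simp add: s_commute[of w] s_add_left)

lemma s_diff_right: "\<lbrakk>x \<in> X; y \<in> X; w \<in> X\<rbrakk> \<Longrightarrow> s w (\<lambda>z. x z - y z) = s w x - s w y"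
  by (simp add: s_commute[of w] s_diff_left)

lemma s_scale_right: "\<lbrakk>x \<in> X; w \<in> X\<rbrakk> \<Longrightarrow> s w (\<lambda>z. c * x z) = cnj c * s w x"
  by (simp add: s_commute[of w] s_scale_left)

lemma s_self: "x \<in> X \<Longrightarrow> s x x = complex_of_real (Re (s x x))"
  using s_commute[of x x] by (simp add: complex_eq_iff)

definition sn :: "('z \<Rightarrow> complex) \<Rightarrow> real" where "sn x = sqrt (Re (s x x))"

lemma sn_nonneg [simp]: "x \<in> X \<Longrightarrow> 0 \<le> sn x" by (simp add: sn_def s_nonneg)

lemma sn_power2: "x \<in> X \<Longrightarrow> (sn x)\<^sup>2 = Re (s x x)" by (simp add: sn_def s_nonneg)

lemma sn_scale: "x \<in> X \<Longrightarrow> sn (\<lambda>z. c * x z) = cmod c * sn x"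
proof -
  assume x: "x \<in> X"
  have "s (\<lambda>z. c * x z) (\<lambda>z. c * x z) = c * cnj c * s x x"
    using x by (simp add: s_scale_left s_scale_right)
  also have "\<dots> = complex_of_real ((cmod c)\<^sup>2 * Re (s x x))"
    using s_self[OF x] by (metis complex_norm_square of_real_mult)
  finally show ?thesis by (simp add: sn_def real_sqrt_mult)
qed

text \<open>Expand \<open>0 \<le> s(x + cy, x + cy)\<close> for a suitable multiple
  \<open>c\<close> of \<open>s x y\<close>; the form may be degenerate, so \<open>s y y = 0\<close> is a separate case.\<close>

lemma cauchy_schwarz:
  assumes x: "x \<in> X" and y: "y \<in> X"
  shows "cmod (s x y) \<le> sn x * sn y"
proof -
  let ?a = "Re (s x x)" and ?b = "Re (s y y)" and ?u = "s x y"
  have expand: "0 \<le> ?a - 2 * t * (cmod ?u)\<^sup>2 + t\<^sup>2 * (cmod ?u)\<^sup>2 * ?b" for t :: real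
  proof -
    \<comment> \<open>With the phase of \<open>s x y\<close> in the factor, the cross terms become real.\<close>
    let ?c = "- (complex_of_real t * ?u)"
    have "s (\<lambda>z. x z + ?c * y z) (\<lambda>z. x z + ?c * y z)
        = s x x + cnj ?c * s x y + ?c * s y x + ?c * cnj ?c * s y y"
      using x y by (simp only: X_closed s_add_left s_add_right s_scale_left s_scale_right)
        (simp add: algebra_simps)
    also have "s y x = cnj ?u" using s_commute x y by blast
    also have "s x x + cnj ?c * s x y + ?c * cnj ?u + ?c * cnj ?c * s y y
        = s x x - 2 * t * (?u * cnj ?u) + t\<^sup>2 * (?u * cnj ?u) * s y y"
      by (simp add: algebra_simps power2_eq_square)
    also have "?u * cnj ?u = complex_of_real ((cmod ?u)\<^sup>2)"
      by (metis complex_norm_square)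
    finally have "Re (s (\<lambda>z. x z + ?c * y z) (\<lambda>z. x z + ?c * y z))
        = ?a - 2 * t * (cmod ?u)\<^sup>2 + t\<^sup>2 * (cmod ?u)\<^sup>2 * ?b"
      by (simp flip: of_real_mult of_real_power)
    then show ?thesis using s_nonneg[of "\<lambda>z. x z + ?c * y z"] x y by simp
  qed
  have "(cmod ?u)\<^sup>2 \<le> ?a * ?b"
  proof (cases "?b = 0")
    case True
    have "(cmod ?u)\<^sup>2 = 0"
    proof (rule ccontr)
      assume "(cmod ?u)\<^sup>2 \<noteq> 0"
      then have "0 < (cmod ?u)\<^sup>2" by simp
      then show False
        using expand[of "(?a + 1) / (2 * (cmod ?u)\<^sup>2)"] True by (simp add: field_simps)
    qed
    then show ?thesis using True by simp
  next
    case False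
    then have b: "?b > 0" using s_nonneg[OF y] by linarith
    then show ?thesis
      using expand[of "1 / ?b"] by (simp add: field_simps power2_eq_square)
  qed
  also have "\<dots> = (sn x * sn y)\<^sup>2" using x y by (simp add: power_mult_distrib sn_power2)
  finally show ?thesis by (rule power2_le_imp_le) (use x y in simp)
qed

lemma sn_triangle:
  assumes x: "x \<in> X" and y: "y \<in> X"
  shows "sn (\<lambda>z. x z + y z) \<le> sn x + sn y"
proof -
  have "(sn (\<lambda>z. x z + y z))\<^sup>2 = Re (s x x) + Re (s x y) + (Re (s y x) + Re (s y y))"
    using x y by (simp add: sn_power2 s_add_left s_add_right)
  also have "Re (s y x) = Re (s x y)" using s_commute[OF x y] by simp
  also have "Re (s x y) \<le> sn x * sn y"
    using cauchy_schwarz[OF x y] complex_Re_le_cmod order_trans by blast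
  finally have "(sn (\<lambda>z. x z + y z))\<^sup>2 \<le> (sn x + sn y)\<^sup>2"
    using x y by (simp add: sn_power2[symmetric] power2_sum)
  then show ?thesis by (rule power2_le_imp_le) (use x y in simp)
qed

definition scauchy :: "(nat \<Rightarrow> 'z \<Rightarrow> complex) \<Rightarrow> bool" where
  "scauchy a \<longleftrightarrow> (\<forall>n. a n \<in> X) \<and> (\<forall>e>0. \<exists>N. \<forall>m\<ge>N. \<forall>n\<ge>N. sn (\<lambda>z. a m z - a n z) < e)"

lemma scauchyD:
  assumes "scauchy a"
  shows "a n \<in> X" "e > 0 \<Longrightarrow> \<exists>N. \<forall>m\<ge>N. \<forall>n\<ge>N. sn (\<lambda>z. a m z - a n z) < e"
  using assms by (auto simp: scauchy_def)

lemma sn_zero [simp]: "sn (\<lambda>z. 0) = 0"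
  using sn_scale[of "\<lambda>z. 0" 0] by simp

lemma scauchy_const: "x \<in> X \<Longrightarrow> scauchy (\<lambda>n. x)"
  by (simp add: scauchy_def)

lemma scauchy_bounded:
  assumes "scauchy a"
  obtains B where "B > 0" "\<And>n. sn (a n) \<le> B"
proof -
  note aX = scauchyD(1)[OF assms]
  obtain N where N: "\<And>n. n \<ge> N \<Longrightarrow> sn (\<lambda>z. a n z - a N z) < 1"
    using scauchyD(2)[OF assms, of 1] by auto
  let ?B = "1 + sn (a N) + (\<Sum>i\<le>N. sn (a i))"
  have pos: "0 \<le> (\<Sum>i\<le>N. sn (a i))" using aX by (intro sum_nonneg) auto
  have "sn (a n) \<le> ?B" for n
  proof (cases "n \<le> N")
    case True
    have "sn (a n) \<le> (\<Sum>i\<le>N. sn (a i))"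
      by (rule member_le_sum) (use True aX in auto)
    then show ?thesis using sn_nonneg[OF aX, of N] by linarith
  next
    case False
    have "sn (a n) \<le> sn (\<lambda>z. a n z - a N z) + sn (a N)"
      using sn_triangle[of "\<lambda>z. a n z - a N z" "a N"] aX by simp
    then show ?thesis using N[of n] False pos by linarith
  qed
  moreover have "?B > 0" using pos sn_nonneg[OF aX, of N] by linarith
  ultimately show thesis using that by blast
qed

lemma scauchy_add:
  assumes a: "scauchy a" and b: "scauchy b"
  shows "scauchy (\<lambda>n z. a n z + b n z)"
proof -
  have "\<exists>N. \<forall>m\<ge>N. \<forall>n\<ge>N. sn (\<lambda>z. (a m z + b m z) - (a n z + b n z)) < e" if e: "e > 0" for e
  proof -
    obtain M N where
      M: "\<And>m n. m \<ge> M \<Longrightarrow> n \<ge> M \<Longrightarrow> sn (\<lambda>z. a m z - a n z) < e / 2" and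
      N: "\<And>m n. m \<ge> N \<Longrightarrow> n \<ge> N \<Longrightarrow> sn (\<lambda>z. b m z - b n z) < e / 2"
      using scauchyD(2)[OF a, of "e/2"] scauchyD(2)[OF b, of "e/2"] e by (metis half_gt_zero)
    have "sn (\<lambda>z. (a m z + b m z) - (a n z + b n z)) < e" if "m \<ge> max M N" "n \<ge> max M N" for m n
    proof -
      have "sn (\<lambda>z. (a m z + b m z) - (a n z + b n z))
          = sn (\<lambda>z. (a m z - a n z) + (b m z - b n z))"
        by (simp add: algebra_simps)
      also have "\<dots> \<le> sn (\<lambda>z. a m z - a n z) + sn (\<lambda>z. b m z - b n z)"
        by (rule sn_triangle) (use scauchyD(1)[OF a] scauchyD(1)[OF b] in auto)
      finally show ?thesis using M[of m n] N[of m n] that by simp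
    qed
    then show ?thesis by blast
  qed
  then show ?thesis
    using scauchyD(1)[OF a] scauchyD(1)[OF b] by (auto simp: scauchy_def)
qed

lemma scauchy_bounded_map:
  assumes a: "scauchy a" and T: "\<And>x. x \<in> X \<Longrightarrow> T x \<in> X"
    and diff: "\<And>x y. x \<in> X \<Longrightarrow> y \<in> X \<Longrightarrow> T (\<lambda>z. x z - y z) = (\<lambda>z. T x z - T y z)"
    and bound: "\<And>x. x \<in> X \<Longrightarrow> sn (T x) \<le> B * sn x"
  shows "scauchy (\<lambda>n. T (a n))"
proof -
  note aX = scauchyD(1)[OF a]
  have "\<exists>N. \<forall>m\<ge>N. \<forall>n\<ge>N. sn (\<lambda>z. T (a m) z - T (a n) z) < e" if e: "e > 0" for e
  proof -
    obtain N where N: "\<And>m n. m \<ge> N \<Longrightarrow> n \<ge> N \<Longrightarrow> sn (\<lambda>z. a m z - a n z) < e / (\<bar>B\<bar> + 1)"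
      using scauchyD(2)[OF a, of "e / (\<bar>B\<bar> + 1)"] e
      by (metis abs_ge_zero add_nonneg_pos divide_pos_pos zero_less_one)
    have "sn (\<lambda>z. T (a m) z - T (a n) z) < e" if "m \<ge> N" "n \<ge> N" for m n
    proof -
      let ?d = "\<lambda>z. a m z - a n z"
      have "sn (\<lambda>z. T (a m) z - T (a n) z) \<le> B * sn ?d"
        using bound[of ?d] diff[OF aX aX] aX by simp
      also have "\<dots> \<le> (\<bar>B\<bar> + 1) * sn ?d" using aX by (intro mult_right_mono) auto
      also have "\<dots> < e" using N[OF that] by (simp add: pos_less_divide_eq mult.commute)
      finally show ?thesis .
    qed
    then show ?thesis by blast
  qed
  then show ?thesis using T aX by (auto simp: scauchy_def)
qed

lemma scauchy_scale: "scauchy a \<Longrightarrow> scauchy (\<lambda>n z. c * a n z)"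
  by (rule scauchy_bounded_map[where T = "\<lambda>x z. c * x z" and B = "cmod c"])
    (auto simp: sn_scale algebra_simps)

lemma scauchy_diff: "scauchy a \<Longrightarrow> scauchy b \<Longrightarrow> scauchy (\<lambda>n z. a n z - b n z)"
  using scauchy_add[of a "\<lambda>n z. (-1) * b n z"] scauchy_scale[of b "-1"] by simp

lemma s_tendsto_zero:
  assumes "\<And>n. d n \<in> X" "(\<lambda>n. sn (d n)) \<longlonglongrightarrow> 0" "\<And>n. b n \<in> X" "\<And>n. sn (b n) \<le> B"
  shows "(\<lambda>n. s (d n) (b n)) \<longlonglongrightarrow> 0" "(\<lambda>n. s (b n) (d n)) \<longlonglongrightarrow> 0"
proof -
  have lim: "(\<lambda>n. sn (d n) * B) \<longlonglongrightarrow> 0" using tendsto_mult_left_zero[OF assms(2)] .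
  have le: "cmod (s (d n) (b n)) \<le> sn (d n) * B" for n
    by (meson assms cauchy_schwarz mult_left_mono order_trans sn_nonneg)
  have "cmod (s (b n) (d n)) = cmod (s (d n) (b n))" for n
    using s_commute[of "b n" "d n"] assms by simp
  then show "(\<lambda>n. s (d n) (b n)) \<longlonglongrightarrow> 0" "(\<lambda>n. s (b n) (d n)) \<longlonglongrightarrow> 0"
    using le by (auto intro: Lim_null_comparison[OF _ lim])
qed

lemma s_convergent:
  assumes a: "scauchy a" and b: "scauchy b"
  shows "convergent (\<lambda>n. s (a n) (b n))"
proof -
  note aX = scauchyD(1)[OF a] and bX = scauchyD(1)[OF b]
  obtain A where A: "A > 0" "\<And>n. sn (a n) \<le> A" using scauchy_bounded[OF a] by blast
  obtain B where B: "B > 0" "\<And>n. sn (b n) \<le> B" using scauchy_bounded[OF b] by blast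
  have "Cauchy (\<lambda>n. s (a n) (b n))"
    unfolding Cauchy_def dist_norm
  proof (intro allI impI)
    fix e :: real assume e: "e > 0"
    obtain M where M: "\<And>m n. m \<ge> M \<Longrightarrow> n \<ge> M \<Longrightarrow> sn (\<lambda>z. a m z - a n z) < e / (2 * B)"
      using scauchyD(2)[OF a, of "e / (2 * B)"] e B by auto
    obtain N where N: "\<And>m n. m \<ge> N \<Longrightarrow> n \<ge> N \<Longrightarrow> sn (\<lambda>z. b m z - b n z) < e / (2 * A)"
      using scauchyD(2)[OF b, of "e / (2 * A)"] e A by auto
    have "cmod (s (a m) (b m) - s (a n) (b n)) < e" if "m \<ge> max M N" "n \<ge> max M N" for m n
    proof -
      have "s (a m) (b m) - s (a n) (b n)
          = s (\<lambda>z. a m z - a n z) (b m) + s (a n) (\<lambda>z. b m z - b n z)"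
        using aX bX by (simp add: s_diff_left s_diff_right)
      then have "cmod (s (a m) (b m) - s (a n) (b n))
          \<le> cmod (s (\<lambda>z. a m z - a n z) (b m)) + cmod (s (a n) (\<lambda>z. b m z - b n z))"
        using norm_triangle_ineq by metis
      also have "cmod (s (\<lambda>z. a m z - a n z) (b m)) \<le> sn (\<lambda>z. a m z - a n z) * B"
        by (rule order_trans[OF cauchy_schwarz]) (use aX bX B in \<open>auto intro: mult_left_mono\<close>)
      also have "\<dots> < (e / (2 * B)) * B" using M[of m n] that B by (intro mult_strict_right_mono) auto
      also have "\<dots> = e / 2" using B by simp
      also have "cmod (s (a n) (\<lambda>z. b m z - b n z)) \<le> A * sn (\<lambda>z. b m z - b n z)"
        by (rule order_trans[OF cauchy_schwarz]) (use aX bX A in \<open>auto intro: mult_right_mono\<close>)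
      also have "\<dots> < A * (e / (2 * A))" using N[of m n] that A by (intro mult_strict_left_mono) auto
      also have "\<dots> = e / 2" using A by simp
      finally show ?thesis by simp
    qed
    then show "\<exists>M. \<forall>m\<ge>M. \<forall>n\<ge>M. cmod (s (a m) (b m) - s (a n) (b n)) < e" by blast
  qed
  then show ?thesis by (rule Cauchy_convergent)
qed

text \<open>In \<open>s(d n, d n) = s(d n, d N) + s(d n, d n - d N)\<close> the second term is small for a large fixed
  \<open>N\<close> by the Cauchy property, and then the first tends to \<open>0\<close> by weak convergence. This lemma is
  what makes a limit functional determine its Cauchy sequence up to null sequences.\<close>

lemma weakly_null_scauchy_is_null:
  assumes d: "scauchy d" and weak: "\<And>y. y \<in> X \<Longrightarrow> (\<lambda>n. s (d n) y) \<longlonglongrightarrow> 0"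
  shows "(\<lambda>n. sn (d n)) \<longlonglongrightarrow> 0"
proof -
  note dX = scauchyD(1)[OF d]
  obtain B where B: "B > 0" "\<And>n. sn (d n) \<le> B" using scauchy_bounded[OF d] by blast
  have "(\<lambda>n. s (d n) (d n)) \<longlonglongrightarrow> 0"
    unfolding LIMSEQ_iff
  proof (intro allI impI)
    fix e :: real assume e: "e > 0"
    obtain N where N: "\<And>n. n \<ge> N \<Longrightarrow> sn (\<lambda>z. d n z - d N z) < e / (2 * B)"
      using scauchyD(2)[OF d, of "e / (2 * B)"] e B by auto
    obtain M where M: "\<And>n. n \<ge> M \<Longrightarrow> cmod (s (d n) (d N)) < e / 2"
      using weak[OF dX, of N] e unfolding LIMSEQ_iff by (metis diff_zero half_gt_zero)
    have "cmod (s (d n) (d n)) < e" if "n \<ge> max M N" for n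
    proof -
      have "s (d n) (d n) = s (d n) (d N) + s (d n) (\<lambda>z. d n z - d N z)"
        using dX by (simp add: s_diff_right)
      then have "cmod (s (d n) (d n)) \<le> cmod (s (d n) (d N)) + cmod (s (d n) (\<lambda>z. d n z - d N z))"
        using norm_triangle_ineq by metis
      also have "cmod (s (d n) (\<lambda>z. d n z - d N z)) \<le> B * sn (\<lambda>z. d n z - d N z)"
        by (rule order_trans[OF cauchy_schwarz]) (use dX B in \<open>auto intro: mult_right_mono\<close>)
      also have "\<dots> < B * (e / (2 * B))" using N[of n] that B by (intro mult_strict_left_mono) auto
      also have "\<dots> = e / 2" using B by simp
      finally show ?thesis using M[of n] that by simp
    qed
    then show "\<exists>no. \<forall>n\<ge>no. cmod (s (d n) (d n) - 0) < e"
      by (intro exI[of _ "max M N"]) simp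
  qed
  then have "(\<lambda>n. sqrt (Re (s (d n) (d n)))) \<longlonglongrightarrow> sqrt (Re 0)"
    by (intro tendsto_real_sqrt tendsto_Re)
  then show ?thesis by (simp add: sn_def)
qed

text \<open>The limit of a Cauchy sequence \<open>a\<close> is recorded as the functional \<open>y \<mapsto> lim s(a n, y)\<close>, so that
  equivalent sequences give literally equal vectors. The value \<open>0\<close> off \<open>X\<close> makes the functional
  unique. Sequences in a subspace \<open>Y\<close> give the closure of \<open>Y\<close> in the completion of \<open>X\<close>, with
  functionals that are still defined on all of \<open>X\<close>; the inclusion of one completion into the other
  is then the identity map.\<close>

definition represents ::
    "('z \<Rightarrow> complex) set \<Rightarrow> (nat \<Rightarrow> 'z \<Rightarrow> complex) \<Rightarrow> (('z \<Rightarrow> complex) \<Rightarrow> complex) \<Rightarrow> bool" where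
  "represents Y a \<phi> \<longleftrightarrow> (\<forall>n. a n \<in> Y) \<and> scauchy a \<and>
     (\<forall>y\<in>X. (\<lambda>n. s (a n) y) \<longlonglongrightarrow> \<phi> y) \<and> (\<forall>y. y \<notin> X \<longrightarrow> \<phi> y = 0)"

lemma representsD:
  assumes "represents Y a \<phi>"
  shows "a n \<in> Y" "a n \<in> X" "scauchy a" "y \<in> X \<Longrightarrow> (\<lambda>n. s (a n) y) \<longlonglongrightarrow> \<phi> y" "y \<notin> X \<Longrightarrow> \<phi> y = 0"
  using assms by (auto simp: represents_def scauchy_def)

lemma represents_X: "represents Y a \<phi> \<Longrightarrow> represents X a \<phi>"
  by (auto simp: represents_def scauchy_def)

definition compl_carrier :: "('z \<Rightarrow> complex) set \<Rightarrow> (('z \<Rightarrow> complex) \<Rightarrow> complex) set" where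
  "compl_carrier Y = {\<phi>. \<exists>a. represents Y a \<phi>}"

text \<open>The chosen sequences do not matter, by \<open>compl_inner_lim\<close> below. The value \<open>0\<close> off the carrier
  is there because the distance of a \<open>Metric_space\<close> must be symmetric and nonnegative for all
  elements of the type.\<close>

definition compl_inner :: "(('z \<Rightarrow> complex) \<Rightarrow> complex) \<Rightarrow> (('z \<Rightarrow> complex) \<Rightarrow> complex) \<Rightarrow> complex" where
  "compl_inner \<phi> \<psi> = (if \<phi> \<in> compl_carrier X \<and> \<psi> \<in> compl_carrier X
     then lim (\<lambda>n. s ((SOME a. represents X a \<phi>) n) ((SOME b. represents X b \<psi>) n)) else 0)"

text \<open>The difference of two sequences with the same limit functional is Cauchy and weakly null.\<close>

lemma represents_unique:
  assumes a: "represents X a \<phi>" and b: "represents X b \<phi>"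
  shows "(\<lambda>n. sn (\<lambda>z. a n z - b n z)) \<longlonglongrightarrow> 0"
proof (rule weakly_null_scauchy_is_null)
  show "scauchy (\<lambda>n z. a n z - b n z)"
    by (rule scauchy_diff[OF representsD(3)[OF a] representsD(3)[OF b]])
  fix y assume y: "y \<in> X"
  have "(\<lambda>n. s (a n) y - s (b n) y) \<longlonglongrightarrow> \<phi> y - \<phi> y"
    by (intro tendsto_diff representsD(4)[OF a y] representsD(4)[OF b y])
  then show "(\<lambda>n. s (\<lambda>z. a n z - b n z) y) \<longlonglongrightarrow> 0"
    using representsD(2)[OF a] representsD(2)[OF b] y by (simp add: s_diff_left)
qed

lemma compl_inner_lim:
  assumes a: "represents Y a \<phi>" and b: "represents Y' b \<psi>"
  shows "(\<lambda>n. s (a n) (b n)) \<longlonglongrightarrow> compl_inner \<phi> \<psi>"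
proof -
  note a = represents_X[OF a] and b = represents_X[OF b]
  define a' where "a' = (SOME a. represents X a \<phi>)"
  define b' where "b' = (SOME b. represents X b \<psi>)"
  have a': "represents X a' \<phi>" unfolding a'_def by (rule someI[of "\<lambda>a. represents X a \<phi>", OF a])
  have b': "represents X b' \<psi>" unfolding b'_def by (rule someI[of "\<lambda>b. represents X b \<psi>", OF b])
  obtain A where A: "\<And>n. sn (a n) \<le> A" using scauchy_bounded[OF representsD(3)[OF a]] by blast
  obtain B where B: "\<And>n. sn (b' n) \<le> B" using scauchy_bounded[OF representsD(3)[OF b']] by blast
  note inX = representsD(2)[OF a] representsD(2)[OF a'] representsD(2)[OF b] representsD(2)[OF b']
  have "(\<lambda>n. s (a' n) (b' n)) \<longlonglongrightarrow> lim (\<lambda>n. s (a' n) (b' n))"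
    using s_convergent[OF representsD(3)[OF a'] representsD(3)[OF b']] convergent_LIMSEQ_iff by blast
  also have "lim (\<lambda>n. s (a' n) (b' n)) = compl_inner \<phi> \<psi>"
    using a b by (auto simp: compl_inner_def a'_def b'_def compl_carrier_def)
  finally have 1: "(\<lambda>n. s (a' n) (b' n)) \<longlonglongrightarrow> compl_inner \<phi> \<psi>" .
  have 2: "(\<lambda>n. s (\<lambda>z. a n z - a' n z) (b' n)) \<longlonglongrightarrow> 0"
    by (rule s_tendsto_zero(1)[OF _ represents_unique[OF a a'] _ B]) (use inX in auto)
  have 3: "(\<lambda>n. s (a n) (\<lambda>z. b n z - b' n z)) \<longlonglongrightarrow> 0"
    by (rule s_tendsto_zero(2)[OF _ represents_unique[OF b b'] _ A]) (use inX in auto)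
  have eq: "s (a n) (b n) = s (a n) (\<lambda>z. b n z - b' n z) + s (\<lambda>z. a n z - a' n z) (b' n) + s (a' n) (b' n)" for n
    using inX by (simp add: s_diff_left s_diff_right)
  show ?thesis
    unfolding eq using tendsto_add[OF tendsto_add[OF 3 2] 1] by simp
qed

definition compl_norm :: "(('z \<Rightarrow> complex) \<Rightarrow> complex) \<Rightarrow> real" where
  "compl_norm \<phi> = sqrt (Re (compl_inner \<phi> \<phi>))"

lemma compl_norm_lim:
  assumes "represents Y a \<phi>"
  shows "(\<lambda>n. sn (a n)) \<longlonglongrightarrow> compl_norm \<phi>"
  unfolding sn_def compl_norm_def
  by (intro tendsto_real_sqrt tendsto_Re compl_inner_lim[OF assms assms])

definition embed :: "('z \<Rightarrow> complex) \<Rightarrow> ('z \<Rightarrow> complex) \<Rightarrow> complex" where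
  "embed x = (\<lambda>y. if y \<in> X then s x y else 0)"

lemma represents_embed: "x \<in> X \<Longrightarrow> x \<in> Y \<Longrightarrow> represents Y (\<lambda>n. x) (embed x)"
  by (simp add: represents_def embed_def scauchy_const)

lemma represents_add:
  assumes a: "represents Y a \<phi>" and b: "represents Y b \<psi>" and Y: "function_subspace Y"
  shows "represents Y (\<lambda>n z. a n z + b n z) (\<lambda>y. \<phi> y + \<psi> y)"
  using representsD[OF a] representsD[OF b] function_subspaceD[OF Y]
  by (auto simp: represents_def s_add_left intro: scauchy_add tendsto_add)

lemma represents_scale:
  assumes a: "represents Y a \<phi>" and Y: "function_subspace Y"
  shows "represents Y (\<lambda>n z. c * a n z) (\<lambda>y. c * \<phi> y)"
  using representsD[OF a] function_subspaceD[OF Y]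
  by (auto simp: represents_def s_scale_left intro: scauchy_scale tendsto_mult_left)

lemma represents_diff:
  assumes a: "represents Y a \<phi>" and b: "represents Y b \<psi>" and Y: "function_subspace Y"
  shows "represents Y (\<lambda>n z. a n z - b n z) (\<lambda>y. \<phi> y - \<psi> y)"
  using represents_add[OF a represents_scale[OF b Y, of "-1"] Y] by simp

lemma compl_carrier_mono: "\<phi> \<in> compl_carrier Y \<Longrightarrow> \<phi> \<in> compl_carrier X"
  using represents_X by (auto simp: compl_carrier_def)

lemma compl_carrier_closed:
  assumes "function_subspace Y"
  shows "\<phi> \<in> compl_carrier Y \<Longrightarrow> \<psi> \<in> compl_carrier Y \<Longrightarrow> (\<lambda>y. \<phi> y + \<psi> y) \<in> compl_carrier Y"
    "\<phi> \<in> compl_carrier Y \<Longrightarrow> (\<lambda>y. c * \<phi> y) \<in> compl_carrier Y"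
    "\<phi> \<in> compl_carrier Y \<Longrightarrow> \<psi> \<in> compl_carrier Y \<Longrightarrow> (\<lambda>y. \<phi> y - \<psi> y) \<in> compl_carrier Y"
proof -
  show "\<phi> \<in> compl_carrier Y \<Longrightarrow> \<psi> \<in> compl_carrier Y \<Longrightarrow> (\<lambda>y. \<phi> y + \<psi> y) \<in> compl_carrier Y"
    using represents_add[OF _ _ assms, where \<phi> = \<phi> and \<psi> = \<psi>]
    unfolding compl_carrier_def mem_Collect_eq by metis
  show "\<phi> \<in> compl_carrier Y \<Longrightarrow> (\<lambda>y. c * \<phi> y) \<in> compl_carrier Y"
    using represents_scale[OF _ assms, where \<phi> = \<phi>]
    unfolding compl_carrier_def mem_Collect_eq by metis
  show "\<phi> \<in> compl_carrier Y \<Longrightarrow> \<psi> \<in> compl_carrier Y \<Longrightarrow> (\<lambda>y. \<phi> y - \<psi> y) \<in> compl_carrier Y"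
    using represents_diff[OF _ _ assms, where \<phi> = \<phi> and \<psi> = \<psi>]
    unfolding compl_carrier_def mem_Collect_eq by metis
qed

lemma embed_in_carrier: "x \<in> X \<Longrightarrow> x \<in> Y \<Longrightarrow> embed x \<in> compl_carrier Y"
  using represents_embed by (auto simp: compl_carrier_def)

lemma compl_inner_nonneg: "0 \<le> Re (compl_inner \<phi> \<phi>)"
proof (cases "\<phi> \<in> compl_carrier X")
  case True
  then obtain a where a: "represents X a \<phi>" by (auto simp: compl_carrier_def)
  show ?thesis
    by (rule LIMSEQ_le_const[OF tendsto_Re[OF compl_inner_lim[OF a a]]])
      (use s_nonneg representsD(2)[OF a] in auto)
qed (simp add: compl_inner_def)

lemma compl_inner_add:
  assumes "\<phi> \<in> compl_carrier X" "\<psi> \<in> compl_carrier X" "\<omega> \<in> compl_carrier X"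
  shows "compl_inner (\<lambda>y. \<phi> y + \<psi> y) \<omega> = compl_inner \<phi> \<omega> + compl_inner \<psi> \<omega>"
proof -
  obtain a b c where *: "represents X a \<phi>" "represents X b \<psi>" "represents X c \<omega>"
    using assms by (auto simp: compl_carrier_def)
  have "(\<lambda>n. s (a n) (c n) + s (b n) (c n)) \<longlonglongrightarrow> compl_inner \<phi> \<omega> + compl_inner \<psi> \<omega>"
    by (intro tendsto_add compl_inner_lim[OF *(1,3)] compl_inner_lim[OF *(2,3)])
  moreover have "(\<lambda>n. s (a n) (c n) + s (b n) (c n)) \<longlonglongrightarrow> compl_inner (\<lambda>y. \<phi> y + \<psi> y) \<omega>"
    using compl_inner_lim[OF represents_add[OF *(1,2) X] *(3)] * [THEN representsD(2)]
    by (simp add: s_add_left)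
  ultimately show ?thesis using LIMSEQ_unique by blast
qed

lemma compl_inner_scale:
  assumes "\<phi> \<in> compl_carrier X" "\<omega> \<in> compl_carrier X"
  shows "compl_inner (\<lambda>y. c * \<phi> y) \<omega> = c * compl_inner \<phi> \<omega>"
proof -
  obtain a b where *: "represents X a \<phi>" "represents X b \<omega>"
    using assms by (auto simp: compl_carrier_def)
  have "(\<lambda>n. c * s (a n) (b n)) \<longlonglongrightarrow> c * compl_inner \<phi> \<omega>"
    by (intro tendsto_mult_left compl_inner_lim[OF *])
  moreover have "(\<lambda>n. c * s (a n) (b n)) \<longlonglongrightarrow> compl_inner (\<lambda>y. c * \<phi> y) \<omega>"
    using compl_inner_lim[OF represents_scale[OF *(1) X] *(2)] * [THEN representsD(2)]
    by (simp add: s_scale_left)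
  ultimately show ?thesis using LIMSEQ_unique by blast
qed

lemma compl_inner_commute: "compl_inner \<phi> \<psi> = cnj (compl_inner \<psi> \<phi>)"
proof (cases "\<phi> \<in> compl_carrier X \<and> \<psi> \<in> compl_carrier X")
  case True
  then obtain a b where *: "represents X a \<phi>" "represents X b \<psi>"
    by (auto simp: compl_carrier_def)
  have "(\<lambda>n. cnj (s (b n) (a n))) \<longlonglongrightarrow> cnj (compl_inner \<psi> \<phi>)"
    by (intro tendsto_cnj compl_inner_lim[OF *(2,1)])
  moreover have "(\<lambda>n. cnj (s (b n) (a n))) \<longlonglongrightarrow> compl_inner \<phi> \<psi>"
    using compl_inner_lim[OF *] s_commute[OF representsD(2)[OF *(1)] representsD(2)[OF *(2)]] by simp
  ultimately show ?thesis using LIMSEQ_unique by blast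
qed (auto simp: compl_inner_def)

lemma compl_inner_definite:
  assumes \<phi>: "\<phi> \<in> compl_carrier X" and 0: "compl_norm \<phi> = 0"
  shows "\<phi> = (\<lambda>y. 0)"
proof
  fix y
  obtain a where a: "represents X a \<phi>" using \<phi> by (auto simp: compl_carrier_def)
  show "\<phi> y = 0"
  proof (cases "y \<in> X")
    case True
    have "(\<lambda>n. s (a n) y) \<longlonglongrightarrow> 0"
      by (rule s_tendsto_zero(1)[where B = "sn y"])
        (use representsD(2)[OF a] True compl_norm_lim[OF a] 0 in auto)
    then show ?thesis using representsD(4)[OF a True] LIMSEQ_unique by blast
  qed (use representsD(5)[OF a] in auto)
qed

lemma compl_norm_triangle:
  assumes "\<phi> \<in> compl_carrier X" "\<psi> \<in> compl_carrier X"
  shows "compl_norm (\<lambda>y. \<phi> y + \<psi> y) \<le> compl_norm \<phi> + compl_norm \<psi>"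
proof -
  obtain a b where *: "represents X a \<phi>" "represents X b \<psi>"
    using assms by (auto simp: compl_carrier_def)
  show ?thesis
    by (rule LIMSEQ_le[OF compl_norm_lim[OF represents_add[OF * X]]
          tendsto_add[OF compl_norm_lim[OF *(1)] compl_norm_lim[OF *(2)]]])
      (use sn_triangle * [THEN representsD(2)] in auto)
qed

lemma compl_norm_minus_commute: "compl_norm (\<lambda>y. \<phi> y - \<psi> y) = compl_norm (\<lambda>y. \<psi> y - \<phi> y)"
proof -
  let ?d = "\<lambda>y. \<phi> y - \<psi> y" and ?e = "\<lambda>y. \<psi> y - \<phi> y"
  have mem: "?d \<in> compl_carrier X \<longleftrightarrow> ?e \<in> compl_carrier X"
    using compl_carrier_closed(2)[OF X, of ?d "-1"] compl_carrier_closed(2)[OF X, of ?e "-1"] by auto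
  show ?thesis
  proof (cases "?d \<in> compl_carrier X")
    case True
    then obtain a where a: "represents X a ?d" by (auto simp: compl_carrier_def)
    have "(\<lambda>n. sn (\<lambda>z. (-1) * a n z)) \<longlonglongrightarrow> compl_norm (\<lambda>y. (-1) * ?d y)"
      by (rule compl_norm_lim[OF represents_scale[OF a X]])
    moreover have "(\<lambda>n. sn (\<lambda>z. (-1) * a n z)) \<longlonglongrightarrow> compl_norm ?d"
      using compl_norm_lim[OF a] sn_scale[OF representsD(2)[OF a], where c = "-1"] by simp
    ultimately have "compl_norm (\<lambda>y. (-1) * ?d y) = compl_norm ?d" using LIMSEQ_unique by blast
    then show ?thesis by simp
  next
    case False
    then show ?thesis using mem by (simp add: compl_norm_def compl_inner_def)
  qed
qed

lemma compl_norm_triangle_diff: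
  assumes "\<phi> \<in> compl_carrier X" "\<psi> \<in> compl_carrier X" "\<omega> \<in> compl_carrier X"
  shows "compl_norm (\<lambda>y. \<phi> y - \<omega> y) \<le> compl_norm (\<lambda>y. \<phi> y - \<psi> y) + compl_norm (\<lambda>y. \<psi> y - \<omega> y)"
  using compl_norm_triangle[of "\<lambda>y. \<phi> y - \<psi> y" "\<lambda>y. \<psi> y - \<omega> y"] compl_carrier_closed[OF X] assms
  by simp

definition hilbert_completion :: "('z \<Rightarrow> complex) set \<Rightarrow> (('z \<Rightarrow> complex) \<Rightarrow> complex) hspace" where
  "hilbert_completion Y = \<lparr>hcarrier = compl_carrier Y, hzero = (\<lambda>y. 0),
     hadd = (\<lambda>\<phi> \<psi> y. \<phi> y + \<psi> y), hscale = (\<lambda>c \<phi> y. c * \<phi> y), hinner = compl_inner\<rparr>"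

lemma completion_simps [simp]:
  "hcarrier (hilbert_completion Y) = compl_carrier Y" "hzero (hilbert_completion Y) = (\<lambda>y. 0)"
  "hadd (hilbert_completion Y) \<phi> \<psi> = (\<lambda>y. \<phi> y + \<psi> y)" "hscale (hilbert_completion Y) c \<phi> = (\<lambda>y. c * \<phi> y)"
  "hinner (hilbert_completion Y) = compl_inner" "hnorm (hilbert_completion Y) = compl_norm"
  by (simp_all add: hilbert_completion_def hnorm_def compl_norm_def fun_eq_iff)

lemma hdist_completion [simp]: "hdist (hilbert_completion Y) \<phi> \<psi> = compl_norm (\<lambda>y. \<phi> y - \<psi> y)"
  by (simp add: hdist_def)

lemma embed_dense:
  assumes a: "represents Y a \<phi>" and e: "e > 0"
  shows "\<exists>x\<in>Y. x \<in> X \<and> compl_norm (\<lambda>y. \<phi> y - embed x y) < e"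
proof -
  note aX = representsD(2)[OF a]
  obtain N where N: "\<And>n. n \<ge> N \<Longrightarrow> sn (\<lambda>z. a n z - a N z) < e / 2"
    using scauchyD(2)[OF representsD(3)[OF a], of "e / 2"] e by auto
  have "(\<lambda>n. sn (\<lambda>z. a n z - a N z)) \<longlonglongrightarrow> compl_norm (\<lambda>y. \<phi> y - embed (a N) y)"
    by (rule compl_norm_lim[OF represents_diff[OF represents_X[OF a] represents_embed[OF aX aX] X]])
  then have "compl_norm (\<lambda>y. \<phi> y - embed (a N) y) \<le> e / 2"
    by (rule LIMSEQ_le_const2) (use N in \<open>auto intro: less_imp_le\<close>)
  then show ?thesis using e aX representsD(1)[OF a] by (intro bexI[of _ "a N"]) auto
qed

lemma Metric_space_completion:
  assumes "function_subspace Y"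
  shows "Metric_space (compl_carrier Y) (hdist (hilbert_completion Y))"
proof
  show "0 \<le> hdist (hilbert_completion Y) \<phi> \<psi>" for \<phi> \<psi>
    by (simp add: compl_norm_def compl_inner_nonneg)
  show "hdist (hilbert_completion Y) \<phi> \<psi> = hdist (hilbert_completion Y) \<psi> \<phi>" for \<phi> \<psi>
    using compl_norm_minus_commute by simp
  show "hdist (hilbert_completion Y) \<phi> \<psi> = 0 \<longleftrightarrow> \<phi> = \<psi>"
    if "\<phi> \<in> compl_carrier Y" "\<psi> \<in> compl_carrier Y" for \<phi> \<psi>
  proof
    have d: "(\<lambda>y. \<phi> y - \<psi> y) \<in> compl_carrier X"
      using compl_carrier_closed(3)[OF X] that[THEN compl_carrier_mono] by blast
    assume "hdist (hilbert_completion Y) \<phi> \<psi> = 0"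
    then show "\<phi> = \<psi>" using compl_inner_definite[OF d] by (auto simp: fun_eq_iff)
  next
    assume "\<phi> = \<psi>"
    then show "hdist (hilbert_completion Y) \<phi> \<psi> = 0"
      using compl_norm_lim[OF represents_embed[OF X_closed(1) X_closed(1)]]
        s_scale_left[of "\<lambda>z. 0" _ 0]
      by (simp add: embed_def LIMSEQ_const_iff cong: if_cong)
  qed
  show "hdist (hilbert_completion Y) \<phi> \<omega> \<le> hdist (hilbert_completion Y) \<phi> \<psi> + hdist (hilbert_completion Y) \<psi> \<omega>"
    if "\<phi> \<in> compl_carrier Y" "\<psi> \<in> compl_carrier Y" "\<omega> \<in> compl_carrier Y" for \<phi> \<psi> \<omega>
    using compl_norm_triangle_diff that[THEN compl_carrier_mono] by simp
qed

text \<open>A Cauchy sequence \<open>\<Phi>\<close> in the completion is approximated by vectors \<open>x k\<close> of \<open>Y\<close> up to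
  \<open>1 / (k + 1)\<close>. These form a Cauchy sequence in \<open>Y\<close>, and the vector that it represents is the limit
  of \<open>\<Phi>\<close>.\<close>

lemma mcomplete_completion:
  assumes Y: "function_subspace Y" "Y \<subseteq> X"
  shows "Metric_space.mcomplete (compl_carrier Y) (hdist (hilbert_completion Y))"
proof -
  interpret Metric_space "compl_carrier Y" "hdist (hilbert_completion Y)"
    by (rule Metric_space_completion[OF Y(1)])
  show ?thesis
    unfolding mcomplete_def
  proof (intro allI impI)
    fix \<Phi> assume "MCauchy \<Phi>"
    then have \<Phi>: "\<And>k. \<Phi> k \<in> compl_carrier Y"
      and Cau: "\<And>e. e > 0 \<Longrightarrow> \<exists>N. \<forall>k\<ge>N. \<forall>l\<ge>N. compl_norm (\<lambda>y. \<Phi> k y - \<Phi> l y) < e"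
      by (auto simp: MCauchy_def)
    have "\<exists>x\<in>Y. x \<in> X \<and> compl_norm (\<lambda>y. \<Phi> k y - embed x y) < inverse (Suc k)" for k
      using \<Phi>[of k] embed_dense[of Y _ "\<Phi> k"] by (force simp: compl_carrier_def)
    then obtain x where xY: "\<And>k. x k \<in> Y" and xX: "\<And>k. x k \<in> X"
      and x: "\<And>k. compl_norm (\<lambda>y. \<Phi> k y - embed (x k) y) < inverse (Suc k)"
      by metis
    have emb: "embed (x k) \<in> compl_carrier X" for k by (rule embed_in_carrier[OF xX xX])
    note \<Phi>X = compl_carrier_mono[OF \<Phi>]
    have sn_eq: "sn (\<lambda>z. x k z - x l z) = compl_norm (\<lambda>y. embed (x k) y - embed (x l) y)" for k l
      using compl_norm_lim[OF represents_diff[OF represents_embed[OF xX xX] represents_embed[OF xX xX] X]]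
      by (simp add: LIMSEQ_const_iff)
    have Cx: "scauchy x"
      unfolding scauchy_def
    proof (intro conjI allI impI)
      show "x n \<in> X" for n by (rule xX)
      fix e :: real assume e: "e > 0"
      obtain N1 where N1: "\<And>k l. k \<ge> N1 \<Longrightarrow> l \<ge> N1 \<Longrightarrow> compl_norm (\<lambda>y. \<Phi> k y - \<Phi> l y) < e / 3"
        using Cau[of "e / 3"] e by auto
      obtain N2 where N2: "inverse (real (Suc N2)) < e / 3"
        using reals_Archimedean[of "e / 3"] e by auto
      have inv: "inverse (real (Suc k)) < e / 3" if "k \<ge> N2" for k
        using N2 that by (smt (verit) Suc_le_mono le_imp_inverse_le of_nat_0_less_iff of_nat_le_iff zero_less_Suc)
      have "sn (\<lambda>z. x k z - x l z) < e" if "k \<ge> max N1 N2" "l \<ge> max N1 N2" for k l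
      proof -
        have "sn (\<lambda>z. x k z - x l z) \<le> compl_norm (\<lambda>y. embed (x k) y - \<Phi> k y) + compl_norm (\<lambda>y. \<Phi> k y - embed (x l) y)"
          unfolding sn_eq by (rule compl_norm_triangle_diff[OF emb \<Phi>X emb])
        also have "compl_norm (\<lambda>y. \<Phi> k y - embed (x l) y)
            \<le> compl_norm (\<lambda>y. \<Phi> k y - \<Phi> l y) + compl_norm (\<lambda>y. \<Phi> l y - embed (x l) y)"
          by (rule compl_norm_triangle_diff[OF \<Phi>X \<Phi>X emb])
        also have "compl_norm (\<lambda>y. embed (x k) y - \<Phi> k y) < e / 3"
          using x[of k] inv[of k] that compl_norm_minus_commute[of "\<Phi> k"] by simp
        also have "compl_norm (\<lambda>y. \<Phi> k y - \<Phi> l y) < e / 3" using N1 that by simp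
        also have "compl_norm (\<lambda>y. \<Phi> l y - embed (x l) y) < e / 3"
          using x[of l] inv[of l] that by simp
        finally show ?thesis by simp
      qed
      then show "\<exists>N. \<forall>m\<ge>N. \<forall>n\<ge>N. sn (\<lambda>z. x m z - x n z) < e" by blast
    qed
    define \<phi> where "\<phi> = (\<lambda>y. if y \<in> X then lim (\<lambda>n. s (x n) y) else 0)"
    have rep: "represents Y x \<phi>"
      using xY Cx s_convergent[OF Cx scauchy_const]
      by (auto simp: represents_def \<phi>_def convergent_LIMSEQ_iff)
    have \<phi>: "\<phi> \<in> compl_carrier Y" using rep by (auto simp: compl_carrier_def)
    have "\<exists>N. \<forall>k\<ge>N. \<Phi> k \<in> compl_carrier Y \<and> hdist (hilbert_completion Y) (\<Phi> k) \<phi> < e" if e: "e > 0" for e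
    proof -
      obtain N1 where N1: "\<And>k l. k \<ge> N1 \<Longrightarrow> l \<ge> N1 \<Longrightarrow> sn (\<lambda>z. x k z - x l z) < e / 2"
        using scauchyD(2)[OF Cx, of "e / 2"] e by auto
      obtain N2 where N2: "inverse (real (Suc N2)) < e / 2"
        using reals_Archimedean[of "e / 2"] e by auto
      have "compl_norm (\<lambda>y. \<Phi> k y - \<phi> y) < e" if k: "k \<ge> max N1 N2" for k
      proof -
        have "inverse (real (Suc k)) < e / 2"
          using N2 k by (smt (verit) Suc_le_mono le_imp_inverse_le max.bounded_iff of_nat_0_less_iff of_nat_le_iff zero_less_Suc)
        then have 1: "compl_norm (\<lambda>y. \<Phi> k y - embed (x k) y) < e / 2" using x[of k] by simp
        have "(\<lambda>n. sn (\<lambda>z. x k z - x n z)) \<longlonglongrightarrow> compl_norm (\<lambda>y. embed (x k) y - \<phi> y)"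
          by (rule compl_norm_lim[OF represents_diff[OF represents_embed[OF xX xX] represents_X[OF rep] X]])
        then have 2: "compl_norm (\<lambda>y. embed (x k) y - \<phi> y) \<le> e / 2"
          by (rule LIMSEQ_le_const2) (use N1[of k] k in \<open>auto intro!: exI[of _ N1] less_imp_le\<close>)
        show ?thesis
          using compl_norm_triangle_diff[OF \<Phi>X emb compl_carrier_mono[OF \<phi>], of k k] 1 2 by linarith
      qed
      then show ?thesis using \<Phi> by (intro exI[of _ "max N1 N2"]) simp
    qed
    then show "\<exists>\<phi>. limitin mtopology \<Phi> \<phi> sequentially"
      using \<phi> unfolding limit_metric_sequentially by blast
  qed
qed

theorem hilbert_space_completion:
  assumes Y: "function_subspace Y" "Y \<subseteq> X"
  shows "hilbert_space (hilbert_completion Y)"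
proof
  have zero: "(\<lambda>y. 0) \<in> compl_carrier Y"
    using compl_carrier_closed(2)[OF Y(1), of "embed (\<lambda>z. 0)" 0]
      embed_in_carrier[OF X_closed(1) function_subspaceD(1)[OF Y(1)]] by simp
  show "hzero (hilbert_completion Y) \<in> hcarrier (hilbert_completion Y)" using zero by simp
  show "x = hzero (hilbert_completion Y)" if "x \<in> hcarrier (hilbert_completion Y)" "hinner (hilbert_completion Y) x x = 0" for x
    using compl_inner_definite[of x] that compl_carrier_mono by (simp add: compl_norm_def)
  show "Metric_space.mcomplete (hcarrier (hilbert_completion Y)) (hdist (hilbert_completion Y))"
    unfolding completion_simps by (rule mcomplete_completion[OF Y])
  show "hinner (hilbert_completion Y) x y = cnj (hinner (hilbert_completion Y) y x)" for x y
    unfolding completion_simps by (rule compl_inner_commute)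
  show "hinner (hilbert_completion Y) (hadd (hilbert_completion Y) x y) z = hinner (hilbert_completion Y) x z + hinner (hilbert_completion Y) y z"
    if "x \<in> hcarrier (hilbert_completion Y)" "y \<in> hcarrier (hilbert_completion Y)" "z \<in> hcarrier (hilbert_completion Y)" for x y z
    using that compl_inner_add[of x y z] compl_carrier_mono[of _ Y] by simp
  show "hinner (hilbert_completion Y) (hscale (hilbert_completion Y) c x) y = c * hinner (hilbert_completion Y) x y"
    if "x \<in> hcarrier (hilbert_completion Y)" "y \<in> hcarrier (hilbert_completion Y)" for c x y
    using that compl_inner_scale[of x y c] compl_carrier_mono[of _ Y] by simp
qed (simp_all add: compl_carrier_closed(1,2)[OF Y(1)] compl_inner_nonneg fun_eq_iff algebra_simps)

end

section \<open>Multiplication operators for a positive functional\<close>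

definition bounded_functions :: "'z set \<Rightarrow> ('z \<Rightarrow> 'c::real_normed_vector) set" where
  "bounded_functions Z = {F. \<exists>B. \<forall>z\<in>Z. norm (F z) \<le> B}"

lemma bounded_functionsI: "(\<And>z. z \<in> Z \<Longrightarrow> norm (F z) \<le> B) \<Longrightarrow> F \<in> bounded_functions Z"
  by (auto simp: bounded_functions_def)

lemma bounded_functionsE:
  assumes "F \<in> bounded_functions Z"
  obtains B where "B > 0" "\<And>z. z \<in> Z \<Longrightarrow> norm (F z) \<le> B"
proof -
  obtain B where "\<And>z. z \<in> Z \<Longrightarrow> norm (F z) \<le> B"
    using assms by (auto simp: bounded_functions_def)
  then show thesis using that[of "\<bar>B\<bar> + 1"] by force
qed

lemma bounded_functions_mult:
  fixes F G :: "'z \<Rightarrow> 'c::real_normed_algebra"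
  assumes "F \<in> bounded_functions Z" "G \<in> bounded_functions Z"
  shows "(\<lambda>z. F z * G z) \<in> bounded_functions Z"
proof -
  obtain A B where "A > 0" "\<And>z. z \<in> Z \<Longrightarrow> norm (F z) \<le> A" "B > 0" "\<And>z. z \<in> Z \<Longrightarrow> norm (G z) \<le> B"
    using bounded_functionsE assms by metis
  then have "norm (F z * G z) \<le> A * B" if "z \<in> Z" for z
    using that by (meson less_imp_le mult_mono norm_ge_zero norm_mult_ineq order_trans)
  then show ?thesis by (rule bounded_functionsI)
qed

lemma bounded_functions_add:
  assumes "F \<in> bounded_functions Z" "G \<in> bounded_functions Z"
  shows "(\<lambda>z. F z + G z) \<in> bounded_functions Z"
proof -
  obtain A B where "A > 0" "\<And>z. z \<in> Z \<Longrightarrow> norm (F z) \<le> A" "B > 0" "\<And>z. z \<in> Z \<Longrightarrow> norm (G z) \<le> B"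
    using bounded_functionsE assms by metis
  then have "norm (F z + G z) \<le> A + B" if "z \<in> Z" for z
    using that by (meson add_mono norm_triangle_ineq order_trans)
  then show ?thesis by (rule bounded_functionsI)
qed

lemma bounded_functions_const: "(\<lambda>z. c) \<in> bounded_functions Z"
  by (rule bounded_functionsI[of _ _ "norm c"]) simp

lemma function_subspace_bounded_functions:
  "function_subspace (bounded_functions Z :: ('z \<Rightarrow> 'c::real_normed_field) set)"
  by (simp add: function_subspace_def bounded_functions_const bounded_functions_add bounded_functions_mult)

lemma bounded_functions_cnj: "F \<in> bounded_functions Z \<Longrightarrow> (\<lambda>z. cnj (F z)) \<in> bounded_functions Z"
  by (simp add: bounded_functions_def)

text \<open>Positivity is stated through real parts; with linearity it makes \<open>\<Theta>\<close> depend only on the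
  values on \<open>Z\<close> (\<open>\<Theta>_cong\<close>).\<close>

locale positive_functional =
  fixes Z :: "'z set" and \<Theta> :: "('z \<Rightarrow> complex) \<Rightarrow> complex"
  assumes \<Theta>_linear: "linear_functional_on (bounded_functions Z) \<Theta>"
    and \<Theta>_cnj: "F \<in> bounded_functions Z \<Longrightarrow> \<Theta> (\<lambda>z. cnj (F z)) = cnj (\<Theta> F)"
    and \<Theta>_positive: "\<lbrakk>F \<in> bounded_functions Z; \<And>z. z \<in> Z \<Longrightarrow> 0 \<le> Re (F z)\<rbrakk> \<Longrightarrow> 0 \<le> Re (\<Theta> F)"
begin

definition form :: "('z \<Rightarrow> complex) \<Rightarrow> ('z \<Rightarrow> complex) \<Rightarrow> complex" where
  "form f g = \<Theta> (\<lambda>z. f z * cnj (g z))"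

lemma \<Theta>_add: "F \<in> bounded_functions Z \<Longrightarrow> G \<in> bounded_functions Z \<Longrightarrow> \<Theta> (\<lambda>z. F z + G z) = \<Theta> F + \<Theta> G"
  and \<Theta>_scale: "F \<in> bounded_functions Z \<Longrightarrow> \<Theta> (\<lambda>z. c * F z) = c * \<Theta> F"
  using \<Theta>_linear by (auto simp: linear_functional_on_def)

lemma \<Theta>_diff:
  assumes "F \<in> bounded_functions Z" "G \<in> bounded_functions Z"
  shows "\<Theta> (\<lambda>z. F z - G z) = \<Theta> F - \<Theta> G"
proof -
  have "(\<lambda>z. - 1 * G z) \<in> bounded_functions Z"
    by (rule function_subspaceD(3)[OF function_subspace_bounded_functions assms(2)])
  from \<Theta>_add[OF assms(1) this] show ?thesis using \<Theta>_scale[OF assms(2), of "- 1"] by simp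
qed

lemma form_in_bounded: "f \<in> bounded_functions Z \<Longrightarrow> g \<in> bounded_functions Z \<Longrightarrow> (\<lambda>z. f z * cnj (g z)) \<in> bounded_functions Z"
  by (intro bounded_functions_mult bounded_functions_cnj)

sublocale semi_inner_functions "bounded_functions Z" form
proof
  show "function_subspace (bounded_functions Z :: ('z \<Rightarrow> complex) set)"
    by (rule function_subspace_bounded_functions)
  show "form (\<lambda>z. x z + y z) w = form x w + form y w"
    if "x \<in> bounded_functions Z" "y \<in> bounded_functions Z" "w \<in> bounded_functions Z" for x y w
    using \<Theta>_add[OF form_in_bounded[OF that(1,3)] form_in_bounded[OF that(2,3)]]
    by (simp add: form_def distrib_right)
  show "form (\<lambda>z. c * x z) w = c * form x w"
    if "x \<in> bounded_functions Z" "w \<in> bounded_functions Z" for x w c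
    using \<Theta>_scale[OF form_in_bounded[OF that]] by (simp add: form_def mult.assoc)
  show "form x y = cnj (form y x)" if "x \<in> bounded_functions Z" "y \<in> bounded_functions Z" for x y
    using \<Theta>_cnj[OF form_in_bounded[OF that(2,1)]] by (simp add: form_def mult.commute)
  show "0 \<le> Re (form x x)" if "x \<in> bounded_functions Z" for x
    unfolding form_def by (rule \<Theta>_positive[OF form_in_bounded[OF that that]]) simp
qed

abbreviation "bdd \<equiv> (bounded_functions Z :: ('z \<Rightarrow> complex) set)"

lemma bdd_mult: "f \<in> bdd \<Longrightarrow> x \<in> bdd \<Longrightarrow> (\<lambda>z. f z * x z) \<in> bdd"
  "f \<in> bdd \<Longrightarrow> x \<in> bdd \<Longrightarrow> (\<lambda>z. cnj (f z) * x z) \<in> bdd"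
  by (intro bounded_functions_mult bounded_functions_cnj; assumption)+

lemma form_mult: "form (\<lambda>z. f z * x z) y = form x (\<lambda>z. cnj (f z) * y z)"
  by (simp add: form_def algebra_simps)

text \<open>Each multiple \<open>c F\<close> has real part \<open>0\<close> on \<open>Z\<close>, so \<open>Re (c \<Theta> F) \<ge> 0\<close>; take the four fourth roots
  of unity for \<open>c\<close>.\<close>

lemma \<Theta>_zero:
  assumes "\<And>z. z \<in> Z \<Longrightarrow> F z = 0"
  shows "\<Theta> F = 0"
proof -
  have F: "F \<in> bounded_functions Z" using assms by (intro bounded_functionsI[of _ _ 0]) simp
  have nonneg: "0 \<le> Re (c * \<Theta> F)" for c
    using \<Theta>_positive[OF function_subspaceD(3)[OF X F], of c] \<Theta>_scale[OF F, of c] assms by simp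
  show ?thesis
    using nonneg[of 1] nonneg[of "-1"] nonneg[of "\<i>"] nonneg[of "- \<i>"] by (simp add: complex_eq_iff)
qed

lemma \<Theta>_cong:
  assumes F: "F \<in> bounded_functions Z" and eq: "\<And>z. z \<in> Z \<Longrightarrow> F z = G z"
  shows "\<Theta> F = \<Theta> G"
proof -
  have G: "G \<in> bounded_functions Z" using assms by (auto simp: bounded_functions_def)
  show ?thesis using \<Theta>_diff[OF F G] \<Theta>_zero[of "\<lambda>z. F z - G z"] eq by simp
qed

text \<open>The function \<open>(B\<^sup>2 - \<bar>f\<bar>\<^sup>2) \<bar>x\<bar>\<^sup>2\<close> is nonnegative on \<open>Z\<close>, so \<open>\<Theta>\<close> is nonnegative on it.\<close>

lemma sn_mult:
  assumes f: "f \<in> bdd" and B: "\<And>z. z \<in> Z \<Longrightarrow> cmod (f z) \<le> B" "0 \<le> B" and x: "x \<in> bdd"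
  shows "sn (\<lambda>z. f z * x z) \<le> B * sn x"
proof -
  let ?g = "\<lambda>z. complex_of_real (B\<^sup>2) * (x z * cnj (x z))"
  let ?h = "\<lambda>z. (f z * x z) * cnj (f z * x z)"
  have fx: "(\<lambda>z. f z * x z) \<in> bdd" by (rule bdd_mult(1)[OF f x])
  have g: "?g \<in> bdd" by (rule X_closed(3)[OF form_in_bounded[OF x x]])
  have h: "?h \<in> bdd" by (rule form_in_bounded[OF fx fx])
  have "0 \<le> Re (\<Theta> (\<lambda>z. ?g z - ?h z))"
  proof (rule \<Theta>_positive)
    show "(\<lambda>z. ?g z - ?h z) \<in> bdd" by (rule X_closed(4)[OF g h])
    fix z assume z: "z \<in> Z"
    have "Re (?g z - ?h z) = (B\<^sup>2 - (cmod (f z))\<^sup>2) * (cmod (x z))\<^sup>2"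
      by (simp only: complex_norm_square[symmetric] norm_mult power_mult_distrib
          of_real_mult[symmetric] of_real_diff[symmetric] Re_complex_of_real left_diff_distrib)
    also have "\<dots> \<ge> 0" using B z by (simp add: power_mono)
    finally show "0 \<le> Re (?g z - ?h z)" .
  qed
  also have "\<Theta> (\<lambda>z. ?g z - ?h z) = complex_of_real (B\<^sup>2) * form x x - form (\<lambda>z. f z * x z) (\<lambda>z. f z * x z)"
    using \<Theta>_diff[OF g h] \<Theta>_scale[OF form_in_bounded[OF x x], of "complex_of_real (B\<^sup>2)"]
    by (simp add: form_def)
  finally have "(sn (\<lambda>z. f z * x z))\<^sup>2 \<le> (B * sn x)\<^sup>2"
    using sn_power2[OF fx] sn_power2[OF x] by (simp add: power_mult_distrib)
  then show ?thesis by (rule power2_le_imp_le) (use B x in simp)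
qed

text \<open>A vector \<open>\<phi>\<close> has the values \<open>\<phi> y = \<langle>\<phi>, y\<rangle>\<close>, so multiplication by \<open>f\<close> on the completion is
  obtained by moving \<open>cnj f\<close> to the argument, without an extension by continuity.\<close>

definition mult_op :: "('z \<Rightarrow> complex) \<Rightarrow> (('z \<Rightarrow> complex) \<Rightarrow> complex) \<Rightarrow> ('z \<Rightarrow> complex) \<Rightarrow> complex" where
  "mult_op f \<phi> = (\<lambda>y. if y \<in> bdd then \<phi> (\<lambda>z. cnj (f z) * y z) else 0)"

lemma represents_mult_op:
  assumes f: "f \<in> bdd" and a: "represents Y a \<phi>" and Y: "\<And>y. y \<in> Y \<Longrightarrow> (\<lambda>z. f z * y z) \<in> Y"
  shows "represents Y (\<lambda>n z. f z * a n z) (mult_op f \<phi>)"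
proof -
  obtain B where B: "B > 0" "\<And>z. z \<in> Z \<Longrightarrow> norm (f z) \<le> B" using bounded_functionsE[OF f] by blast
  have "scauchy (\<lambda>n z. f z * a n z)"
    by (rule scauchy_bounded_map[OF representsD(3)[OF a], where T = "\<lambda>x z. f z * x z" and B = B])
      (use bdd_mult(1)[OF f] sn_mult[OF f B(2)] B(1) in \<open>auto simp: algebra_simps\<close>)
  moreover have "(\<lambda>n. form (\<lambda>z. f z * a n z) y) \<longlonglongrightarrow> mult_op f \<phi> y" if "y \<in> bdd" for y
    using representsD(4)[OF a bdd_mult(2)[OF f that]] that by (simp add: form_mult mult_op_def)
  ultimately show ?thesis
    using Y representsD(1)[OF a] by (auto simp: represents_def mult_op_def)
qed

lemma mult_op_closed:
  assumes "f \<in> bdd" "\<And>y. y \<in> Y \<Longrightarrow> (\<lambda>z. f z * y z) \<in> Y" "\<phi> \<in> compl_carrier Y"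
  shows "mult_op f \<phi> \<in> compl_carrier Y"
  using represents_mult_op[OF assms(1) _ assms(2)] assms(3) by (auto simp: compl_carrier_def)

lemma compl_inner_mult_op:
  assumes f: "f \<in> bdd" and "\<phi> \<in> compl_carrier bdd" "\<psi> \<in> compl_carrier bdd"
  shows "compl_inner (mult_op f \<phi>) \<psi> = compl_inner \<phi> (mult_op (\<lambda>z. cnj (f z)) \<psi>)"
proof -
  obtain a b where *: "represents bdd a \<phi>" "represents bdd b \<psi>"
    using assms by (auto simp: compl_carrier_def)
  have "(\<lambda>n. form (\<lambda>z. f z * a n z) (b n)) \<longlonglongrightarrow> compl_inner (mult_op f \<phi>) \<psi>"
    by (intro compl_inner_lim[OF represents_mult_op[OF f *(1)] *(2)] bdd_mult[OF f])
  moreover have "(\<lambda>n. form (a n) (\<lambda>z. cnj (f z) * b n z)) \<longlonglongrightarrow> compl_inner \<phi> (mult_op (\<lambda>z. cnj (f z)) \<psi>)"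
    by (intro compl_inner_lim[OF *(1) represents_mult_op[OF bounded_functions_cnj[OF f] *(2)]] bdd_mult(2)[OF f])
  ultimately show ?thesis unfolding form_mult using LIMSEQ_unique by blast
qed

lemma compl_norm_mult_op:
  assumes f: "f \<in> bdd" and B: "\<And>z. z \<in> Z \<Longrightarrow> cmod (f z) \<le> B" "0 \<le> B" and \<phi>: "\<phi> \<in> compl_carrier bdd"
  shows "compl_norm (mult_op f \<phi>) \<le> B * compl_norm \<phi>"
proof -
  obtain a where a: "represents bdd a \<phi>" using \<phi> by (auto simp: compl_carrier_def)
  show ?thesis
    by (rule LIMSEQ_le[OF compl_norm_lim[OF represents_mult_op[OF f a]]
          tendsto_mult_left[OF compl_norm_lim[OF a]]])
      (use sn_mult[OF f B] representsD(2)[OF a] bdd_mult[OF f] in auto)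
qed

text \<open>Vectors are antilinear in their argument because the form is, and this turns the sums and
  multiples of functions into sums and multiples of operators.\<close>

lemma compl_carrier_antilinear:
  assumes \<phi>: "\<phi> \<in> compl_carrier bdd" and x: "x \<in> bdd" and y: "y \<in> bdd"
  shows "\<phi> (\<lambda>z. x z + y z) = \<phi> x + \<phi> y" "\<phi> (\<lambda>z. c * x z) = cnj c * \<phi> x"
proof -
  obtain a where a: "represents bdd a \<phi>" using \<phi> by (auto simp: compl_carrier_def)
  note aX = representsD(2)[OF a]
  show "\<phi> (\<lambda>z. x z + y z) = \<phi> x + \<phi> y"
    using LIMSEQ_unique[OF representsD(4)[OF a X_closed(2)[OF x y]]]
      tendsto_add[OF representsD(4)[OF a x] representsD(4)[OF a y]] aX x y
    by (simp add: s_add_right)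
  show "\<phi> (\<lambda>z. c * x z) = cnj c * \<phi> x"
    using LIMSEQ_unique[OF representsD(4)[OF a X_closed(3)[OF x, of c]]]
      tendsto_mult_left[OF representsD(4)[OF a x], of "cnj c"] aX x
    by (simp add: s_scale_right)
qed

lemma compl_carrier_cong:
  assumes \<phi>: "\<phi> \<in> compl_carrier bdd" and x: "x \<in> bdd" and eq: "\<And>z. z \<in> Z \<Longrightarrow> x z = y z"
  shows "\<phi> x = \<phi> y"
proof -
  obtain a where a: "represents bdd a \<phi>" using \<phi> by (auto simp: compl_carrier_def)
  have y: "y \<in> bdd" using x eq by (auto simp: bounded_functions_def)
  have "form (a n) x = form (a n) y" for n
    unfolding form_def by (rule \<Theta>_cong[OF form_in_bounded[OF representsD(2)[OF a] x]]) (simp add: eq)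
  then show ?thesis
    using LIMSEQ_unique[OF representsD(4)[OF a x]] representsD(4)[OF a y] by simp
qed

text \<open>The adjoint is defined by a definite description, so besides a candidate \<open>z\<close> uniqueness is
  needed: if \<open>w\<close> is another one, \<open>w - z\<close> is orthogonal to the whole space.\<close>

lemma hadjoint_completion:
  assumes z: "z \<in> compl_carrier Y" and Y: "function_subspace Y"
    and adj: "\<And>x. x \<in> compl_carrier Y \<Longrightarrow> hinner L (T x) y = compl_inner x z"
  shows "hadjoint (hilbert_completion Y) L T y = z"
  unfolding hadjoint_def completion_simps
proof (rule the_equality)
  show "z \<in> compl_carrier Y \<and> (\<forall>x\<in>compl_carrier Y. hinner L (T x) y = compl_inner x z)"
    using z adj by blast
  fix w assume w: "w \<in> compl_carrier Y \<and> (\<forall>x\<in>compl_carrier Y. hinner L (T x) y = compl_inner x w)"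
  let ?d = "\<lambda>y. w y - z y"
  have d: "?d \<in> compl_carrier Y" by (rule compl_carrier_closed(3)[OF Y]) (use w z in auto)
  note inX = compl_carrier_mono[OF d] compl_carrier_mono[OF z] compl_carrier_mono[OF conjunct1[OF w]]
  have "compl_inner ?d w = compl_inner ?d z" using w d adj by metis
  then have "compl_inner w ?d = compl_inner z ?d"
    using compl_inner_commute[of w ?d] compl_inner_commute[of z ?d] by simp
  moreover have "compl_inner w ?d = compl_inner ?d ?d + compl_inner z ?d"
    using compl_inner_add[OF inX(1,2,1)] by simp
  ultimately have "?d = (\<lambda>y. 0)"
    by (intro compl_inner_definite[OF inX(1)]) (simp add: compl_norm_def)
  then show "w = z" by (simp add: fun_eq_iff)
qed

text \<open>Functions on \<open>K\<close> act through a map \<open>P\<close> from \<open>Z\<close> to \<open>K\<close>. Both actions of the dilation are of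
  this form, with the two coordinates for \<open>P\<close>.\<close>

theorem star_representation_mult_op:
  fixes P :: "'z \<Rightarrow> 'a::topological_space"
  assumes Y: "function_subspace Y" "Y \<subseteq> bdd" and P: "\<And>z. z \<in> Z \<Longrightarrow> P z \<in> K"
    and bounded: "\<And>f. f \<in> CK K \<Longrightarrow> f \<in> bounded_functions K"
    and Yf: "\<And>f y. f \<in> CK K \<Longrightarrow> y \<in> Y \<Longrightarrow> (\<lambda>z. f (P z) * y z) \<in> Y"
  shows "star_representation K (hilbert_completion Y) (\<lambda>f. mult_op (\<lambda>z. f (P z)))"
proof -
  have fP: "(\<lambda>z. f (P z)) \<in> bdd" if f: "f \<in> CK K" for f
    using bounded[OF f] P by (auto simp: bounded_functions_def)
  note toX = compl_carrier_mono[of _ Y]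
  have cnjK: "(\<lambda>x. cnj (f x)) \<in> CK K" if "f \<in> CK K" for f
    using that by (auto simp: CK_def intro: continuous_on_cnj)
  have closed: "mult_op (\<lambda>z. f (P z)) \<phi> \<in> compl_carrier Y" if "f \<in> CK K" "\<phi> \<in> compl_carrier Y" for f \<phi>
    by (rule mult_op_closed[OF fP[OF that(1)] Yf[OF that(1)] that(2)])
  show ?thesis
    unfolding star_representation_def completion_simps
  proof (intro conjI ballI allI)
    fix f assume f: "f \<in> CK K"
    obtain B where B: "B > 0" "\<And>z. z \<in> Z \<Longrightarrow> cmod (f (P z)) \<le> B"
      using bounded_functionsE[OF fP[OF f]] by blast
    show "hbounded (hilbert_completion Y) (hilbert_completion Y) (mult_op (\<lambda>z. f (P z)))"
      unfolding hbounded_def hlinear_def completion_simps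
    proof (intro conjI ballI allI)
      show "mult_op (\<lambda>z. f (P z)) \<phi> \<in> compl_carrier Y" if "\<phi> \<in> compl_carrier Y" for \<phi>
        by (rule closed[OF f that])
      show "\<exists>B. \<forall>\<phi>\<in>compl_carrier Y. compl_norm (mult_op (\<lambda>z. f (P z)) \<phi>) \<le> B * compl_norm \<phi>"
        using compl_norm_mult_op[OF fP[OF f] B(2)] B(1) toX by (intro exI[of _ B]) auto
    qed (auto simp: mult_op_def fun_eq_iff)
  next
    fix f g \<phi> assume f: "f \<in> CK K" and g: "g \<in> CK K" and \<phi>: "\<phi> \<in> compl_carrier Y"
    show "mult_op (\<lambda>z. f (P z) + g (P z)) \<phi> = (\<lambda>y. mult_op (\<lambda>z. f (P z)) \<phi> y + mult_op (\<lambda>z. g (P z)) \<phi> y)"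
      using compl_carrier_antilinear(1)[OF toX[OF \<phi>] bdd_mult(2)[OF fP[OF f]] bdd_mult(2)[OF fP[OF g]]]
      by (auto simp: mult_op_def fun_eq_iff algebra_simps)
    show "mult_op (\<lambda>z. f (P z) * g (P z)) \<phi> = mult_op (\<lambda>z. f (P z)) (mult_op (\<lambda>z. g (P z)) \<phi>)"
      using bdd_mult(2)[OF fP[OF f]] by (auto simp: mult_op_def fun_eq_iff algebra_simps)
  next
    fix c f \<phi> assume f: "f \<in> CK K" and \<phi>: "\<phi> \<in> compl_carrier Y"
    show "mult_op (\<lambda>z. c * f (P z)) \<phi> = (\<lambda>y. c * mult_op (\<lambda>z. f (P z)) \<phi> y)"
      using compl_carrier_antilinear(2)[OF toX[OF \<phi>] bdd_mult(2)[OF fP[OF f]], of _ "\<lambda>z. 0" "cnj c"]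
      by (auto simp: mult_op_def fun_eq_iff mult.assoc)
  next
    fix f \<phi> assume f: "f \<in> CK K" and \<phi>: "\<phi> \<in> compl_carrier Y"
    have "hadjoint (hilbert_completion Y) (hilbert_completion Y) (mult_op (\<lambda>z. f (P z))) \<phi> = mult_op (\<lambda>z. cnj (f (P z))) \<phi>"
    proof (rule hadjoint_completion[OF _ Y(1)])
      show "mult_op (\<lambda>z. cnj (f (P z))) \<phi> \<in> compl_carrier Y" using closed[OF cnjK[OF f] \<phi>] .
      fix \<psi> assume "\<psi> \<in> compl_carrier Y"
      then show "hinner (hilbert_completion Y) (mult_op (\<lambda>z. f (P z)) \<psi>) \<phi> = compl_inner \<psi> (mult_op (\<lambda>z. cnj (f (P z))) \<phi>)"
        using compl_inner_mult_op[OF fP[OF f] toX toX[OF \<phi>]] by simp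
    qed
    then show "mult_op (\<lambda>z. cnj (f (P z))) \<phi> = hadjoint (hilbert_completion Y) (hilbert_completion Y) (mult_op (\<lambda>z. f (P z))) \<phi>"
      by simp
  next
    fix \<phi> assume \<phi>: "\<phi> \<in> compl_carrier Y"
    have "\<phi> (\<lambda>z. cnj (indicator K (P z)) * y z) = \<phi> y" if "y \<in> bdd" for y
      by (rule compl_carrier_cong[OF toX[OF \<phi>] that, symmetric]) (simp add: P)
    moreover have "\<phi> y = 0" if "y \<notin> bdd" for y
      using \<phi> that by (auto simp: compl_carrier_def represents_def)
    ultimately show "mult_op (\<lambda>z. indicator K (P z)) \<phi> = \<phi>" by (auto simp: mult_op_def fun_eq_iff)
  qed
qed

lemma mult_op_embed:
  assumes f: "f \<in> bdd" and x: "x \<in> bdd"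
  shows "mult_op f (embed x) = embed (\<lambda>z. f z * x z)"
  using bdd_mult(2)[OF f] by (auto simp: mult_op_def embed_def form_mult fun_eq_iff)

lemma compl_inner_embed: "x \<in> bdd \<Longrightarrow> y \<in> bdd \<Longrightarrow> compl_inner (embed x) (embed y) = form x y"
  using compl_inner_lim[OF represents_embed represents_embed] by (auto simp: LIMSEQ_const_iff)

lemma gns_vector_state:
  assumes "f \<in> bdd"
  shows "compl_inner (mult_op f (embed (\<lambda>z. 1))) (embed (\<lambda>z. 1)) = \<Theta> f"
  using assms by (simp add: mult_op_embed compl_inner_embed bounded_functions_const form_def)

end

section \<open>A positive coupling of measures in Choquet order\<close>

text \<open>By compactness of \<open>C\<close> the functions \<open>f(x, -)\<close> depend on \<open>x\<close> continuously with respect to the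
  uniform distance on \<open>C\<close>, and the supremum is 1-Lipschitz for that distance.\<close>

lemma continuous_on_SUP_compact:
  fixes f :: "'a::topological_space \<times> 'b::topological_space \<Rightarrow> real"
  assumes cont: "continuous_on (U \<times> C) f" and C: "compact C" "C \<noteq> {}"
  shows "continuous_on U (\<lambda>x. SUP t\<in>C. f (x, t))"
  unfolding continuous_on_def
proof (intro ballI tendstoI)
  fix x0 and e :: real
  assume x0: "x0 \<in> U" and e: "e > 0"
  have bdd: "bdd_above ((\<lambda>t. f (x, t)) ` C)" if "x \<in> U" for x
  proof -
    have "continuous_on C (\<lambda>t. f (x, t))"
      by (rule continuous_on_compose2[OF cont]) (use that in \<open>auto intro!: continuous_intros\<close>)
    then show ?thesis using C by (simp add: compact_continuous_image compact_imp_bounded bounded_imp_bdd_above)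
  qed
  obtain X0 where X0: "x0 \<in> X0" "open X0"
    and near: "\<forall>x\<in>X0 \<inter> U. \<forall>t\<in>C. dist (f (x, t)) (f (x0, t)) \<le> e / 2"
    by (rule continuous_on_prod_compactE[OF cont C(1) x0 half_gt_zero[OF e]])
  have close: "\<bar>f (x, t) - f (x0, t)\<bar> \<le> e / 2" if "x \<in> X0" "x \<in> U" "t \<in> C" for x t
    using near that by (auto simp: dist_real_def)
  have "dist (SUP t\<in>C. f (x, t)) (SUP t\<in>C. f (x0, t)) < e" if x: "x \<in> X0" "x \<in> U" for x
  proof -
    have "f (x, t) \<le> (SUP t\<in>C. f (x0, t)) + e / 2" if "t \<in> C" for t
      using close[OF x that] cSUP_upper[OF that bdd[OF x0]] by linarith
    then have 1: "(SUP t\<in>C. f (x, t)) \<le> (SUP t\<in>C. f (x0, t)) + e / 2"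
      by (rule cSUP_least[OF C(2)])
    have "f (x0, t) \<le> (SUP t\<in>C. f (x, t)) + e / 2" if "t \<in> C" for t
      using close[OF x that] cSUP_upper[OF that bdd[OF x(2)]] by linarith
    then have 2: "(SUP t\<in>C. f (x0, t)) \<le> (SUP t\<in>C. f (x, t)) + e / 2"
      by (rule cSUP_least[OF C(2)])
    show ?thesis using 1 2 e by (simp add: dist_real_def)
  qed
  then show "\<forall>\<^sub>F x in at x0 within U. dist (SUP t\<in>C. f (x, t)) (SUP t\<in>C. f (x0, t)) < e"
    unfolding eventually_at_topological using X0 by blast
qed

lemma continuous_on_bounded_functions:
  fixes f :: "'a::topological_space \<Rightarrow> 'b::real_normed_vector"
  assumes "compact K" "continuous_on K f"
  shows "f \<in> bounded_functions K"
  using compact_imp_bounded[OF compact_continuous_image[OF assms(2,1)]]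
  by (auto simp: bounded_functions_def bounded_iff)

lemma Mplus_space: "\<mu> \<in> Mplus K \<Longrightarrow> space \<mu> = K"
  using sets_eq_imp_space_eq[of \<mu> "restrict_space borel K"]
  by (simp add: Mplus_def space_restrict_space)

lemma Mplus_integrable:
  fixes f :: "'a::topological_space \<Rightarrow> 'b::{banach,second_countable_topology}"
  assumes K: "compact K" and \<mu>: "\<mu> \<in> Mplus K" and f: "continuous_on K f"
  shows "integrable \<mu> f"
proof -
  interpret finite_measure \<mu> using \<mu> by (simp add: Mplus_def)
  obtain B where B: "\<And>x. x \<in> K \<Longrightarrow> norm (f x) \<le> B"
    using bounded_functionsE[OF continuous_on_bounded_functions[OF K f]] by blast
  have sets: "sets \<mu> = sets (restrict_space borel K)" using \<mu> by (simp add: Mplus_def)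
  have "f \<in> borel_measurable (restrict_space borel K)"
    by (rule borel_measurable_continuous_on_restrict[OF f])
  then have "f \<in> borel_measurable \<mu>"
    by (simp add: measurable_cong_sets[OF sets refl])
  then show ?thesis
    by (intro integrable_const_bound[of _ B]) (auto simp: Mplus_space[OF \<mu>] B)
qed

definition affine_in_snd ::
    "'a::real_vector set \<Rightarrow> ('a \<times> 'a \<Rightarrow> 'c::real_vector) \<Rightarrow> bool" where
  "affine_in_snd K d \<longleftrightarrow> (\<forall>x\<in>K. \<forall>y\<in>K. \<forall>y'\<in>K. \<forall>t\<in>{0..1}.
     d (x, (1 - t) *\<^sub>R y + t *\<^sub>R y') = (1 - t) *\<^sub>R d (x, y) + t *\<^sub>R d (x, y'))"

lemma continuous_on_diagonal:
  assumes "continuous_on (K \<times> K) d"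
  shows "continuous_on K (\<lambda>x. d (x, x))"
  by (rule continuous_on_compose2[OF assms]) (auto intro!: continuous_intros)

text \<open>Put \<open>\<phi>(y) = sup\<^sub>x -d(x,y)\<close>. As a supremum of affine functions over a compact set it is convex
  and continuous. By hypothesis \<open>\<phi> \<le> f\<close>, and \<open>x = y\<close> gives \<open>-d(y,y) \<le> \<phi>(y)\<close>. Hence
  \<open>-\<integral> d(x,x) d\<mu> \<le> \<integral> \<phi> d\<mu> \<le> \<integral> \<phi> d\<nu> \<le> \<integral> f d\<nu>\<close>, the middle step being the Choquet order.\<close>

lemma choquet_le_positivity:
  fixes K :: "'a::locally_convex_space set" and d :: "'a \<times> 'a \<Rightarrow> real"
  assumes K: "compact K" "convex K" and \<mu>: "\<mu> \<in> Mplus K" and \<nu>: "\<nu> \<in> Mplus K"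
    and le: "choquet_le K \<mu> \<nu>"
    and d: "continuous_on (K \<times> K) d" "affine_in_snd K d" and f: "continuous_on K f"
    and nonneg: "\<And>x y. x \<in> K \<Longrightarrow> y \<in> K \<Longrightarrow> 0 \<le> d (x, y) + f y"
  shows "0 \<le> (\<integral>x. d (x, x) \<partial>\<mu>) + (\<integral>x. f x \<partial>\<nu>)"
proof (cases "K = {}")
  case True
  then have "(\<integral>x. d (x, x) \<partial>\<mu>) = 0" "(\<integral>x. f x \<partial>\<nu>) = 0"
    using Mplus_space[OF \<mu>] Mplus_space[OF \<nu>] by (simp_all add: Bochner_Integration.integral_empty)
  then show ?thesis by simp
next
  case False
  define \<phi> where "\<phi> = (\<lambda>y. SUP x\<in>K. - d (x, y))"
  have "continuous_on (K \<times> K) (\<lambda>p. - d (snd p, fst p))"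
    by (intro continuous_on_minus continuous_on_compose2[OF d(1)]) (auto intro!: continuous_intros)
  from continuous_on_SUP_compact[OF this K(1) False]
  have \<phi>_cont: "continuous_on K \<phi>" by (simp add: \<phi>_def)
  have bdd: "bdd_above ((\<lambda>x. - d (x, y)) ` K)" if "y \<in> K" for y
  proof -
    have "continuous_on K (\<lambda>x. - d (x, y))"
      by (intro continuous_on_minus continuous_on_compose2[OF d(1)])
        (use that in \<open>auto intro!: continuous_intros\<close>)
    then show ?thesis
      by (intro bounded_imp_bdd_above compact_imp_bounded compact_continuous_image K(1))
  qed
  have upper: "- d (x, y) \<le> \<phi> y" if "x \<in> K" "y \<in> K" for x y
    unfolding \<phi>_def using that bdd by (intro cSUP_upper) auto
  have \<phi>_conv: "convex_on K \<phi>"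
  proof (rule convex_onI)
    show "convex K" by fact
    fix t :: real and y y' assume t: "0 < t" "t < 1" and y: "y \<in> K" "y' \<in> K"
    show "\<phi> ((1 - t) *\<^sub>R y + t *\<^sub>R y') \<le> (1 - t) * \<phi> y + t * \<phi> y'"
      unfolding \<phi>_def[THEN fun_cong, of "(1 - t) *\<^sub>R y + t *\<^sub>R y'"]
    proof (rule cSUP_least[OF False])
      fix x assume x: "x \<in> K"
      have "d (x, (1 - t) *\<^sub>R y + t *\<^sub>R y') = (1 - t) * d (x, y) + t * d (x, y')"
        using d(2) x y t by (simp add: affine_in_snd_def)
      then have "- d (x, (1 - t) *\<^sub>R y + t *\<^sub>R y') = (1 - t) * (- d (x, y)) + t * (- d (x, y'))"
        by (simp add: algebra_simps)
      also have "\<dots> \<le> (1 - t) * \<phi> y + t * \<phi> y'"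
        using upper x y t by (intro add_mono mult_left_mono) auto
      finally show "- d (x, (1 - t) *\<^sub>R y + t *\<^sub>R y') \<le> (1 - t) * \<phi> y + t * \<phi> y'" .
    qed
  qed
  have "(\<integral>x. - d (x, x) \<partial>\<mu>) \<le> (\<integral>x. \<phi> x \<partial>\<mu>)"
    by (intro integral_mono Mplus_integrable[OF K(1) \<mu>] continuous_on_minus continuous_on_diagonal d \<phi>_cont)
      (simp add: Mplus_space[OF \<mu>] upper)
  also have "\<dots> \<le> (\<integral>x. \<phi> x \<partial>\<nu>)"
    using le \<phi>_cont \<phi>_conv by (simp add: choquet_le_def)
  also have "\<dots> \<le> (\<integral>x. f x \<partial>\<nu>)"
  proof (intro integral_mono Mplus_integrable[OF K(1) \<nu>] \<phi>_cont f)
    fix y assume "y \<in> space \<nu>"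
    then have y: "y \<in> K" by (simp add: Mplus_space[OF \<nu>])
    have "- d (x, y) \<le> f y" if "x \<in> K" for x using nonneg[OF that y] by linarith
    then show "\<phi> y \<le> f y" unfolding \<phi>_def by (rule cSUP_least[OF False])
  qed
  finally show ?thesis by simp
qed

text \<open>The functional comes from the Hahn--Banach theorem for
  \<open>p F = inf {\<integral> d(x,x) d\<mu> + \<integral> f d\<nu> | F(x,y) \<le> d(x,y) + f(y)}\<close>, which is finite by
  \<open>choquet_le_positivity\<close>. A functional below \<open>p\<close> is nonpositive on nonpositive functions, and
  comparing it with \<open>p\<close> at \<open>\<plusminus>(d(x,y) + f(y))\<close> gives its value there.\<close>

lemma choquet_le_coupling:
  fixes K :: "'a::locally_convex_space set"
  assumes K: "compact K" "convex K" and \<mu>: "\<mu> \<in> Mplus K" and \<nu>: "\<nu> \<in> Mplus K"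
    and le: "choquet_le K \<mu> \<nu>"
  obtains \<theta> :: "('a \<times> 'a \<Rightarrow> real) \<Rightarrow> real"
  where "linear_functional_on (bounded_functions (K \<times> K)) \<theta>"
    "\<And>F. F \<in> bounded_functions (K \<times> K) \<Longrightarrow> (\<And>z. z \<in> K \<times> K \<Longrightarrow> 0 \<le> F z) \<Longrightarrow> 0 \<le> \<theta> F"
    "\<And>d. continuous_on (K \<times> K) d \<Longrightarrow> affine_in_snd K d \<Longrightarrow> \<theta> d = (\<integral>x. d (x, x) \<partial>\<mu>)"
    "\<And>f. continuous_on K f \<Longrightarrow> \<theta> (\<lambda>z. f (snd z)) = (\<integral>x. f x \<partial>\<nu>)"
proof -
  let ?S = "bounded_functions (K \<times> K) :: ('a \<times> 'a \<Rightarrow> real) set"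
  \<comment> \<open>\<open>M F\<close> is the set of majorants of \<open>F\<close>, and \<open>v\<close> the value prescribed on them.\<close>
  define M where "M = (\<lambda>F :: 'a \<times> 'a \<Rightarrow> real. {(d, f).
    continuous_on (K \<times> K) d \<and> affine_in_snd K d \<and> continuous_on K f \<and>
    (\<forall>x\<in>K. \<forall>y\<in>K. F (x, y) \<le> d (x, y) + f y)})"
  define v where "v = (\<lambda>(d :: 'a \<times> 'a \<Rightarrow> real, f :: 'a \<Rightarrow> real). (\<integral>x. d (x, x) \<partial>\<mu>) + (\<integral>x. f x \<partial>\<nu>))"
  define p where "p = (\<lambda>F. INF m\<in>M F. v m)"
  have S: "function_subspace ?S" by (rule function_subspace_bounded_functions)
  note int_d = Mplus_integrable[OF K(1) \<mu> continuous_on_diagonal]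
  note int_f = Mplus_integrable[OF K(1) \<nu>]
  have MI: "(d, f) \<in> M F" if "continuous_on (K \<times> K) d" "affine_in_snd K d" "continuous_on K f"
    "\<And>x y. x \<in> K \<Longrightarrow> y \<in> K \<Longrightarrow> F (x, y) \<le> d (x, y) + f y" for d f F
    using that by (auto simp: M_def)
  have nonempty: "M F \<noteq> {}" if F: "F \<in> ?S" for F
  proof -
    obtain B where B: "\<And>z. z \<in> K \<times> K \<Longrightarrow> norm (F z) \<le> B" using bounded_functionsE[OF F] by blast
    have "(\<lambda>_. B, \<lambda>_. 0) \<in> M F"
    proof (rule MI)
      fix x y assume "x \<in> K" "y \<in> K"
      then show "F (x, y) \<le> B + 0" using B[of "(x, y)"] by simp
    qed (auto simp: affine_in_snd_def algebra_simps)
    then show ?thesis by blast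
  qed
  have lower: "\<exists>b. \<forall>m\<in>M F. b \<le> v m" if F: "F \<in> ?S" for F
  proof -
    obtain B where B: "\<And>z. z \<in> K \<times> K \<Longrightarrow> norm (F z) \<le> B" using bounded_functionsE[OF F] by blast
    \<comment> \<open>Since \<open>-B \<le> F\<close>, the pair \<open>(d + B, f)\<close> satisfies the positivity hypothesis.\<close>
    have "- (\<integral>x. B \<partial>\<mu>) \<le> v m" if "m \<in> M F" for m
    proof -
      obtain d f where m: "m = (d, f)" and d: "continuous_on (K \<times> K) d" "affine_in_snd K d"
        and f: "continuous_on K f" and maj: "\<And>x y. x \<in> K \<Longrightarrow> y \<in> K \<Longrightarrow> F (x, y) \<le> d (x, y) + f y"
        using \<open>m \<in> M F\<close> by (auto simp: M_def)
      have "0 \<le> (\<integral>x. d (x, x) + B \<partial>\<mu>) + (\<integral>x. f x \<partial>\<nu>)"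
      proof (rule choquet_le_positivity[OF K \<mu> \<nu> le, where d = "\<lambda>z. d z + B", simplified])
        show "continuous_on (K \<times> K) (\<lambda>z. d z + B)" by (intro continuous_intros d)
        show "affine_in_snd K (\<lambda>z. d z + B)"
          using d(2) by (auto simp: affine_in_snd_def algebra_simps)
        show "0 \<le> d (x, y) + B + f y" if "x \<in> K" "y \<in> K" for x y
          using maj[OF that] B[of "(x, y)"] that by simp
      qed (rule f)
      also have "(\<integral>x. d (x, x) + B \<partial>\<mu>) = (\<integral>x. d (x, x) \<partial>\<mu>) + (\<integral>x. B \<partial>\<mu>)"
        by (intro Bochner_Integration.integral_add int_d d Mplus_integrable[OF K(1) \<mu>] continuous_intros)
      finally show ?thesis by (simp add: v_def m)
    qed
    then show ?thesis by blast
  qed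
  have p_le: "p F \<le> v m" if "F \<in> ?S" "m \<in> M F" for F m
    unfolding p_def using lower[OF that(1)] that(2) by (intro cINF_lower) (auto intro: bdd_belowI2)
  have p_ge: "b \<le> p F" if "F \<in> ?S" "\<And>m. m \<in> M F \<Longrightarrow> b \<le> v m" for F b
    unfolding p_def using nonempty[OF that(1)] that(2) by (intro cINF_greatest) auto
  have "sublinear_on ?S p"
    unfolding sublinear_on_def
  proof (intro conjI ballI allI impI)
    fix F G assume F: "F \<in> ?S" and G: "G \<in> ?S"
    have FG: "(\<lambda>z. F z + G z) \<in> ?S" by (rule function_subspaceD(2)[OF S F G])
    have *: "p (\<lambda>z. F z + G z) \<le> v m + v n" if "m \<in> M F" "n \<in> M G" for m n
    proof -
      obtain d f where m: "m = (d, f)" and d: "continuous_on (K \<times> K) d" "affine_in_snd K d"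
        and f: "continuous_on K f" and maj: "\<And>x y. x \<in> K \<Longrightarrow> y \<in> K \<Longrightarrow> F (x, y) \<le> d (x, y) + f y"
        using \<open>m \<in> M F\<close> by (auto simp: M_def)
      obtain e g where n: "n = (e, g)" and e: "continuous_on (K \<times> K) e" "affine_in_snd K e"
        and g: "continuous_on K g" and maj': "\<And>x y. x \<in> K \<Longrightarrow> y \<in> K \<Longrightarrow> G (x, y) \<le> e (x, y) + g y"
        using \<open>n \<in> M G\<close> by (auto simp: M_def)
      have "(\<lambda>z. d z + e z, \<lambda>x. f x + g x) \<in> M (\<lambda>z. F z + G z)"
      proof (rule MI)
        show "affine_in_snd K (\<lambda>z. d z + e z)"
          using d(2) e(2) by (simp add: affine_in_snd_def algebra_simps)
        show "F (x, y) + G (x, y) \<le> d (x, y) + e (x, y) + (f y + g y)" if "x \<in> K" "y \<in> K" for x y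
          using maj[OF that] maj'[OF that] by linarith
      qed (intro continuous_intros d e f g)+
      then have "p (\<lambda>z. F z + G z) \<le> v (\<lambda>z. d z + e z, \<lambda>x. f x + g x)" by (rule p_le[OF FG])
      also have "\<dots> = v m + v n"
        using int_d[OF d(1)] int_d[OF e(1)] int_f[OF f] int_f[OF g] by (simp add: v_def m n)
      finally show ?thesis .
    qed
    have "p (\<lambda>z. F z + G z) - v n \<le> p F" if "n \<in> M G" for n
      using * that by (intro p_ge[OF F]) (simp add: algebra_simps)
    then have "p (\<lambda>z. F z + G z) - p F \<le> p G"
      by (intro p_ge[OF G]) (simp add: algebra_simps)
    then show "p (\<lambda>z. F z + G z) \<le> p F + p G" by linarith
  next
    fix c :: real and F assume c: "c > 0" and F: "F \<in> ?S"
    have cF: "(\<lambda>z. c * F z) \<in> ?S" by (rule function_subspaceD(3)[OF S F])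
    have "p (\<lambda>z. c * F z) / c \<le> v m" if "m \<in> M F" for m
    proof -
      obtain d f where m: "m = (d, f)" and d: "continuous_on (K \<times> K) d" "affine_in_snd K d"
        and f: "continuous_on K f" and maj: "\<And>x y. x \<in> K \<Longrightarrow> y \<in> K \<Longrightarrow> F (x, y) \<le> d (x, y) + f y"
        using \<open>m \<in> M F\<close> by (auto simp: M_def)
      have "(\<lambda>z. c * d z, \<lambda>x. c * f x) \<in> M (\<lambda>z. c * F z)"
      proof (rule MI)
        show "affine_in_snd K (\<lambda>z. c * d z)"
          using d(2) by (simp add: affine_in_snd_def distrib_left mult.left_commute)
        show "c * F (x, y) \<le> c * d (x, y) + c * f y" if "x \<in> K" "y \<in> K" for x y
          using mult_left_mono[OF maj[OF that], of c] c by (simp add: algebra_simps)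
      qed (intro continuous_intros d f)+
      then have "p (\<lambda>z. c * F z) \<le> v (\<lambda>z. c * d z, \<lambda>x. c * f x)" by (rule p_le[OF cF])
      also have "\<dots> = c * v m"
        using int_d[OF d(1)] int_f[OF f] by (simp add: v_def m algebra_simps)
      finally show ?thesis using c by (simp add: divide_le_eq mult.commute)
    qed
    then have "p (\<lambda>z. c * F z) / c \<le> p F" by (rule p_ge[OF F])
    then show "p (\<lambda>z. c * F z) \<le> c * p F" using c by (simp add: divide_le_eq mult.commute)
  qed
  with S obtain \<theta> where lin: "linear_functional_on ?S \<theta>" and dom: "\<And>F. F \<in> ?S \<Longrightarrow> \<theta> F \<le> p F"
    using hahn_banach_sublinear by blast
  have \<theta>_uminus: "\<theta> (\<lambda>z. - F z) = - \<theta> F" if "F \<in> ?S" for F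
  proof -
    have "\<theta> (\<lambda>z. (-1) * F z) = (-1) * \<theta> F"
      using lin that unfolding linear_functional_on_def by blast
    then show ?thesis by simp
  qed
  have \<theta>_le: "\<theta> F \<le> v (d, f)" if "F \<in> ?S" "(d, f) \<in> M F" for F d f
    using dom[OF that(1)] p_le[OF that] by linarith
  have \<theta>_eq: "\<theta> F = v (d, f)"
    if F: "F \<in> ?S" and d: "continuous_on (K \<times> K) d" "affine_in_snd K d" and f: "continuous_on K f"
      and eq: "\<And>x y. x \<in> K \<Longrightarrow> y \<in> K \<Longrightarrow> F (x, y) = d (x, y) + f y" for F d f
  proof (rule antisym)
    show "\<theta> F \<le> v (d, f)" by (intro \<theta>_le MI F d f) (simp add: eq)
    have "affine_in_snd K (\<lambda>z. - d z)" using d(2) by (simp add: affine_in_snd_def algebra_simps)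
    then have "\<theta> (\<lambda>z. - F z) \<le> v (\<lambda>z. - d z, \<lambda>x. - f x)"
      by (intro \<theta>_le MI function_subspace_uminus[OF S] F continuous_on_minus d f) (auto simp: eq)
    also have "\<dots> = - v (d, f)" using int_d[OF d(1)] int_f[OF f] by (simp add: v_def)
    finally show "v (d, f) \<le> \<theta> F" using \<theta>_uminus[OF F] by simp
  qed
  have KK: "compact (K \<times> K)" by (intro compact_Times K)
  show thesis
  proof
    show "linear_functional_on ?S \<theta>" by fact
    show "0 \<le> \<theta> F" if F: "F \<in> ?S" and pos: "\<And>z. z \<in> K \<times> K \<Longrightarrow> 0 \<le> F z" for F
    proof -
      have "\<theta> (\<lambda>z. - F z) \<le> v (\<lambda>_. 0, \<lambda>_. 0)"
        by (intro \<theta>_le MI function_subspace_uminus[OF S] F) (use pos in \<open>auto simp: affine_in_snd_def\<close>)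
      then show ?thesis using \<theta>_uminus[OF F] by (simp add: v_def)
    qed
    show "\<theta> d = (\<integral>x. d (x, x) \<partial>\<mu>)" if "continuous_on (K \<times> K) d" "affine_in_snd K d" for d
      using \<theta>_eq[of d d "\<lambda>_. 0"] that continuous_on_bounded_functions[OF KK that(1)] by (simp add: v_def)
    show "\<theta> (\<lambda>z. f (snd z)) = (\<integral>x. f x \<partial>\<nu>)" if f: "continuous_on K f" for f
    proof -
      have "continuous_on (K \<times> K) (\<lambda>z. f (snd z))"
        by (rule continuous_on_compose2[OF f]) (auto intro!: continuous_intros)
      from continuous_on_bounded_functions[OF KK this] show ?thesis
        using \<theta>_eq[of "\<lambda>z. f (snd z)" "\<lambda>_. 0" f] f by (simp add: v_def affine_in_snd_def)
    qed
  qed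
qed

section \<open>The dilation\<close>

text \<open>A real vector space is either trivial or infinite, and an infinite set is equinumerous with its
  square. The bijection serves only to carry the functions on \<open>K \<times> K\<close> over to functions on \<open>'a\<close>.\<close>

lemma ex_bij_prod: "\<exists>b :: 'a::real_vector \<Rightarrow> 'a \<times> 'a. bij b"
proof (cases "\<exists>x :: 'a. x \<noteq> 0")
  case True
  then obtain x :: 'a where "x \<noteq> 0" by blast
  then have "inj (\<lambda>r :: real. r *\<^sub>R x)" by (auto simp: inj_on_def)
  then have "infinite (range (\<lambda>r :: real. r *\<^sub>R x))"
    using infinite_UNIV_char_0 finite_imageD by blast
  then have "infinite (UNIV :: 'a set)" using finite_subset subset_UNIV by blast
  then have "\<exists>f. bij_betw f ((UNIV :: 'a set) \<times> (UNIV :: 'a set)) (UNIV :: 'a set)"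
    unfolding card_of_ordIso by (rule card_of_Times_same_infinite)
  then obtain f :: "'a \<times> 'a \<Rightarrow> 'a" where "bij f" by auto
  then show ?thesis using bij_imp_bij_inv by blast
next
  case False
  then have "x = y" for x y :: 'a by metis
  then have "bij (\<lambda>x :: 'a. (x, x))"
    by (intro bijI injI surjI[where f = fst]) (auto simp: prod_eq_iff)
  then show ?thesis by blast
qed

lemma CK_bounded: "compact K \<Longrightarrow> f \<in> CK K \<Longrightarrow> f \<in> bounded_functions K"
  by (auto simp: CK_def intro: continuous_on_bounded_functions)

lemma positive_functional_complexify:
  fixes \<theta> :: "('w \<Rightarrow> real) \<Rightarrow> real"
  assumes lin: "linear_functional_on (bounded_functions W) \<theta>"
    and pos: "\<And>F. F \<in> bounded_functions W \<Longrightarrow> (\<And>w. w \<in> W \<Longrightarrow> 0 \<le> F w) \<Longrightarrow> 0 \<le> \<theta> F"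
  shows "positive_functional W (\<lambda>F. Complex (\<theta> (\<lambda>w. Re (F w))) (\<theta> (\<lambda>w. Im (F w))))"
proof
  have add: "\<theta> (\<lambda>w. F w + G w) = \<theta> F + \<theta> G"
    if "F \<in> bounded_functions W" "G \<in> bounded_functions W" for F G
    using lin that by (auto simp: linear_functional_on_def)
  have scale: "\<theta> (\<lambda>w. c * F w) = c * \<theta> F" if "F \<in> bounded_functions W" for c F
    using lin that by (auto simp: linear_functional_on_def)
  have scale_in: "(\<lambda>w. c * F w) \<in> bounded_functions W" if "F \<in> bounded_functions W" for c and F :: "'w \<Rightarrow> real"
    by (rule function_subspaceD(3)[OF function_subspace_bounded_functions that])
  have uminus: "\<theta> (\<lambda>w. - F w) = - \<theta> F" if "F \<in> bounded_functions W" for F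
    using scale[OF that, of "-1"] by simp
  have diff: "\<theta> (\<lambda>w. c * F w - e * G w) = c * \<theta> F - e * \<theta> G"
    if "F \<in> bounded_functions W" "G \<in> bounded_functions W" for c e F G
    using add[OF scale_in[OF that(1), of c] scale_in[OF that(2), of "- e"]] scale[OF that(1)] scale[OF that(2), of "- e"] by simp
  have ReIm: "(\<lambda>w. Re (F w)) \<in> bounded_functions W" "(\<lambda>w. Im (F w)) \<in> bounded_functions W"
    if F: "F \<in> bounded_functions W" for F :: "'w \<Rightarrow> complex"
  proof -
    obtain B where B: "\<And>w. w \<in> W \<Longrightarrow> cmod (F w) \<le> B" using bounded_functionsE[OF F] by blast
    have "\<bar>Re (F w)\<bar> \<le> B" "\<bar>Im (F w)\<bar> \<le> B" if "w \<in> W" for w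
      using B[OF that] abs_Re_le_cmod[of "F w"] abs_Im_le_cmod[of "F w"] by linarith+
    then show "(\<lambda>w. Re (F w)) \<in> bounded_functions W" "(\<lambda>w. Im (F w)) \<in> bounded_functions W"
      by (auto intro!: bounded_functionsI[of _ _ B])
  qed
  show "linear_functional_on (bounded_functions W) (\<lambda>F. Complex (\<theta> (\<lambda>w. Re (F w))) (\<theta> (\<lambda>w. Im (F w))))"
    unfolding linear_functional_on_def
  proof (intro conjI ballI allI)
    fix F G :: "'w \<Rightarrow> complex"
    assume F: "F \<in> bounded_functions W" and G: "G \<in> bounded_functions W"
    show "Complex (\<theta> (\<lambda>w. Re (F w + G w))) (\<theta> (\<lambda>w. Im (F w + G w)))
        = Complex (\<theta> (\<lambda>w. Re (F w))) (\<theta> (\<lambda>w. Im (F w))) + Complex (\<theta> (\<lambda>w. Re (G w))) (\<theta> (\<lambda>w. Im (G w)))"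
      by (simp add: add ReIm F G complex_eq_iff)
  next
    fix c and F :: "'w \<Rightarrow> complex" assume F: "F \<in> bounded_functions W"
    have "\<theta> (\<lambda>w. Im (c * F w)) = Re c * \<theta> (\<lambda>w. Im (F w)) + Im c * \<theta> (\<lambda>w. Re (F w))"
      using diff[OF ReIm(2)[OF F] ReIm(1)[OF F], of "Re c" "- Im c"] by simp
    then show "Complex (\<theta> (\<lambda>w. Re (c * F w))) (\<theta> (\<lambda>w. Im (c * F w)))
        = c * Complex (\<theta> (\<lambda>w. Re (F w))) (\<theta> (\<lambda>w. Im (F w)))"
      using diff[OF ReIm[OF F], of "Re c" "Im c"] by (simp add: complex_eq_iff)
  qed
  fix F :: "'w \<Rightarrow> complex" assume F: "F \<in> bounded_functions W"
  show "Complex (\<theta> (\<lambda>w. Re (cnj (F w)))) (\<theta> (\<lambda>w. Im (cnj (F w))))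
      = cnj (Complex (\<theta> (\<lambda>w. Re (F w))) (\<theta> (\<lambda>w. Im (F w))))"
    by (simp add: uminus ReIm F complex_eq_iff)
  show "0 \<le> Re (Complex (\<theta> (\<lambda>w. Re (F w))) (\<theta> (\<lambda>w. Im (F w))))" if "\<And>w. w \<in> W \<Longrightarrow> 0 \<le> Re (F w)"
    using pos[OF ReIm(1)[OF F]] that by simp
qed

lemma positive_functional_pullback:
  assumes \<Theta>: "positive_functional W \<Theta>" and b: "bij b"
  shows "positive_functional (b -` W) (\<lambda>F. \<Theta> (\<lambda>w. F (inv b w)))"
proof -
  interpret positive_functional W \<Theta> by fact
  have surj: "b (inv b w) = w" for w by (rule surj_f_inv_f[OF bij_is_surj[OF b]])
  have bd: "(\<lambda>w. F (inv b w)) \<in> bounded_functions W" if F: "F \<in> bounded_functions (b -` W)" for F :: "'b \<Rightarrow> complex"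
  proof -
    obtain B where B: "\<And>z. z \<in> b -` W \<Longrightarrow> cmod (F z) \<le> B" using bounded_functionsE[OF F] by blast
    show ?thesis by (rule bounded_functionsI[of _ _ B], rule B) (simp add: surj)
  qed
  show ?thesis
  proof
    show "linear_functional_on (bounded_functions (b -` W)) (\<lambda>F. \<Theta> (\<lambda>w. F (inv b w)))"
      using \<Theta>_add \<Theta>_scale bd by (auto simp: linear_functional_on_def)
    show "\<Theta> (\<lambda>w. cnj (F (inv b w))) = cnj (\<Theta> (\<lambda>w. F (inv b w)))" if "F \<in> bounded_functions (b -` W)" for F
      using \<Theta>_cnj[OF bd[OF that]] .
    show "0 \<le> Re (\<Theta> (\<lambda>w. F (inv b w)))"
      if "F \<in> bounded_functions (b -` W)" "\<And>z. z \<in> b -` W \<Longrightarrow> 0 \<le> Re (F z)" for F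
      using \<Theta>_positive[OF bd[OF that(1)]] that(2) by (simp add: surj)
  qed
qed

lemma choquet_le_complex_coupling:
  fixes K :: "'a::locally_convex_space set"
  assumes K: "compact K" "convex K" and \<mu>: "\<mu> \<in> Mplus K" and \<nu>: "\<nu> \<in> Mplus K"
    and le: "choquet_le K \<mu> \<nu>"
  obtains \<Theta> :: "('a \<times> 'a \<Rightarrow> complex) \<Rightarrow> complex"
  where "positive_functional (K \<times> K) \<Theta>"
    "\<And>d. continuous_on (K \<times> K) d \<Longrightarrow> affine_in_snd K d \<Longrightarrow> \<Theta> d = (\<integral>x. d (x, x) \<partial>\<mu>)"
    "\<And>f. continuous_on K f \<Longrightarrow> \<Theta> (\<lambda>z. f (snd z)) = (\<integral>x. f x \<partial>\<nu>)"
proof -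
  obtain \<theta> :: "('a \<times> 'a \<Rightarrow> real) \<Rightarrow> real" where lin: "linear_functional_on (bounded_functions (K \<times> K)) \<theta>"
    and pos: "\<And>F. F \<in> bounded_functions (K \<times> K) \<Longrightarrow> (\<And>z. z \<in> K \<times> K \<Longrightarrow> 0 \<le> F z) \<Longrightarrow> 0 \<le> \<theta> F"
    and \<theta>\<mu>: "\<And>d. continuous_on (K \<times> K) d \<Longrightarrow> affine_in_snd K d \<Longrightarrow> \<theta> d = (\<integral>x. d (x, x) \<partial>\<mu>)"
    and \<theta>\<nu>: "\<And>f. continuous_on K f \<Longrightarrow> \<theta> (\<lambda>z. f (snd z)) = (\<integral>x. f x \<partial>\<nu>)"
    using choquet_le_coupling[OF assms] by blast
  show thesis
  proof
    show "positive_functional (K \<times> K) (\<lambda>F. Complex (\<theta> (\<lambda>w. Re (F w))) (\<theta> (\<lambda>w. Im (F w))))"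
      by (rule positive_functional_complexify[OF lin pos])
    show "Complex (\<theta> (\<lambda>w. Re (d w))) (\<theta> (\<lambda>w. Im (d w))) = (\<integral>x. d (x, x) \<partial>\<mu>)"
      if d: "continuous_on (K \<times> K) d" "affine_in_snd K d" for d
    proof -
      have int: "integrable \<mu> (\<lambda>x. d (x, x))"
        by (rule Mplus_integrable[OF K(1) \<mu> continuous_on_diagonal[OF d(1)]])
      have "affine_in_snd K (\<lambda>w. Re (d w))" "affine_in_snd K (\<lambda>w. Im (d w))"
        using d(2) by (simp_all add: affine_in_snd_def)
      moreover have "continuous_on (K \<times> K) (\<lambda>w. Re (d w))" "continuous_on (K \<times> K) (\<lambda>w. Im (d w))"
        by (intro continuous_intros d)+
      ultimately show ?thesis
        using \<theta>\<mu>[of "\<lambda>w. Re (d w)"] \<theta>\<mu>[of "\<lambda>w. Im (d w)"] int by (simp add: complex_eq_iff)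
    qed
    show "Complex (\<theta> (\<lambda>w. Re (f (snd w)))) (\<theta> (\<lambda>w. Im (f (snd w)))) = (\<integral>x. f x \<partial>\<nu>)"
      if f: "continuous_on K f" for f
    proof -
      have int: "integrable \<nu> f" by (rule Mplus_integrable[OF K(1) \<nu> f])
      have "continuous_on K (\<lambda>w. Re (f w))" "continuous_on K (\<lambda>w. Im (f w))"
        by (intro continuous_intros f)+
      then show ?thesis
        using \<theta>\<nu>[of "\<lambda>w. Re (f w)"] \<theta>\<nu>[of "\<lambda>w. Im (f w)"] int by (simp add: complex_eq_iff)
    qed
  qed
qed

theorem corollary6p5:
  fixes K :: "'a::locally_convex_space set" and \<mu> \<nu> :: "'a measure"
  assumes "compact K" and "convex K"
    and "\<mu> \<in> Mplus K" and "\<nu> \<in> Mplus K"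
    and "choquet_le K \<mu> \<nu>"
  shows "dilation_le K \<mu> \<nu>"
proof -
  obtain \<Theta>0 :: "('a \<times> 'a \<Rightarrow> complex) \<Rightarrow> complex" where \<Theta>0: "positive_functional (K \<times> K) \<Theta>0"
    and \<Theta>\<mu>: "\<And>d. continuous_on (K \<times> K) d \<Longrightarrow> affine_in_snd K d \<Longrightarrow> \<Theta>0 d = (\<integral>x. d (x, x) \<partial>\<mu>)"
    and \<Theta>\<nu>: "\<And>f. continuous_on K f \<Longrightarrow> \<Theta>0 (\<lambda>z. f (snd z)) = (\<integral>x. f x \<partial>\<nu>)"
    using choquet_le_complex_coupling[OF assms] by blast
  obtain b :: "'a \<Rightarrow> 'a \<times> 'a" where b: "bij b" using ex_bij_prod by blast
  define Z where "Z = b -` (K \<times> K)"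
  define P where "P = (\<lambda>z. fst (b z))"
  define Q where "Q = (\<lambda>z. snd (b z))"
  define \<Theta> where "\<Theta> = (\<lambda>F. \<Theta>0 (\<lambda>w. F (inv b w)))"
  interpret positive_functional Z \<Theta>
    unfolding Z_def \<Theta>_def by (rule positive_functional_pullback[OF \<Theta>0 b])
  have \<Theta>_PQ: "\<Theta> (\<lambda>z. d (P z, Q z)) = \<Theta>0 d" for d
    by (simp add: \<Theta>_def P_def Q_def surj_f_inv_f[OF bij_is_surj[OF b]])
  have PK: "P z \<in> K" and QK: "Q z \<in> K" if "z \<in> Z" for z
    using that by (auto simp: Z_def P_def Q_def mem_Times_iff)
  \<comment> \<open>The functions that depend on the first coordinate only. Agreement is asked on \<open>Z\<close> alone, since
    the constant \<open>1\<close> must belong to \<open>Y\<close> while members of \<open>CK K\<close> vanish off \<open>K\<close>.\<close>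
  define Y where "Y = {y. \<exists>g\<in>CK K. \<forall>z\<in>Z. y z = g (P z)}"
  note CK_bdd = CK_bounded[OF assms(1)]
  have CKP: "(\<lambda>z. f (P z)) \<in> bdd" and CKQ: "(\<lambda>z. f (Q z)) \<in> bdd" if "f \<in> CK K" for f
    using CK_bdd[OF that] PK QK by (auto simp: bounded_functions_def)
  have CK_mult: "(\<lambda>x. f x * g x) \<in> CK K" and CK_add: "(\<lambda>x. f x + g x) \<in> CK K"
    if "f \<in> CK K" "g \<in> CK K" for f g
    using that by (auto simp: CK_def intro: continuous_intros)
  have CK_scale: "(\<lambda>x. c * f x) \<in> CK K" if "f \<in> CK K" for c f
    using that by (auto simp: CK_def intro: continuous_intros)
  have CK_zero: "(\<lambda>x. 0) \<in> CK K" by (simp add: CK_def)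
  have CK_one: "(indicator K :: 'a \<Rightarrow> complex) \<in> CK K"
    using continuous_on_cong[of K K "indicator K" "\<lambda>_. 1 :: complex"] by (simp add: CK_def)
  have Y: "function_subspace Y" "Y \<subseteq> bdd"
  proof -
    show "function_subspace Y"
      unfolding function_subspace_def
    proof (intro conjI ballI allI)
      show "(\<lambda>z. 0) \<in> Y" unfolding Y_def using CK_zero by auto
      fix x assume "x \<in> Y"
      then obtain g where g: "g \<in> CK K" "\<forall>z\<in>Z. x z = g (P z)" by (auto simp: Y_def)
      show "(\<lambda>z. c * x z) \<in> Y" for c
        using g CK_scale[OF g(1), of c] by (auto simp: Y_def intro!: bexI[of _ "\<lambda>x. c * g x"])
      fix y assume "y \<in> Y"
      then obtain h where h: "h \<in> CK K" "\<forall>z\<in>Z. y z = h (P z)" by (auto simp: Y_def)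
      show "(\<lambda>z. x z + y z) \<in> Y"
        using g h CK_add[OF g(1) h(1)] by (auto simp: Y_def intro!: bexI[of _ "\<lambda>x. g x + h x"])
    qed
    show "Y \<subseteq> bdd"
      using CK_bdd PK by (fastforce simp: Y_def bounded_functions_def)
  qed
  have YP: "(\<lambda>z. f (P z) * y z) \<in> Y" if f: "f \<in> CK K" and y: "y \<in> Y" for f y
  proof -
    obtain g where g: "g \<in> CK K" "\<forall>z\<in>Z. y z = g (P z)" using y by (auto simp: Y_def)
    then show ?thesis
      using CK_mult[OF f g(1)] by (auto simp: Y_def intro!: bexI[of _ "\<lambda>x. f x * g x"])
  qed
  define H where "H = hilbert_completion Y"
  define L where "L = hilbert_completion bdd"
  define \<pi> where "\<pi> = (\<lambda>f. mult_op (\<lambda>z. f (P z)))"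
  define \<sigma> where "\<sigma> = (\<lambda>f. mult_op (\<lambda>z. f (Q z)))"
  define \<xi> where "\<xi> = embed (\<lambda>z. 1)"
  have one_Y: "(\<lambda>z. 1) \<in> Y"
    unfolding Y_def using CK_one PK by (auto intro!: bexI[of _ "indicator K"])
  have one_X: "(\<lambda>z. 1) \<in> bdd" by (rule bounded_functions_const)
  have "measure_representation K \<mu> \<pi> H \<xi>"
    unfolding measure_representation_def
  proof (intro conjI ballI)
    show "hilbert_space H" unfolding H_def by (rule hilbert_space_completion[OF Y])
    show "star_representation K H \<pi>"
      unfolding H_def \<pi>_def by (rule star_representation_mult_op[where P = P, OF Y PK CK_bdd YP])
    show "\<xi> \<in> hcarrier H" using embed_in_carrier[OF one_X one_Y] by (simp add: H_def \<xi>_def)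
    fix f assume f: "f \<in> CK K"
    have "continuous_on (K \<times> K) (\<lambda>w. f (fst w))"
      by (rule continuous_on_compose2[of K f]) (use f in \<open>auto simp: CK_def intro!: continuous_intros\<close>)
    moreover have "affine_in_snd K (\<lambda>w. f (fst w))"
      by (simp add: affine_in_snd_def flip: scaleR_add_left)
    ultimately have "\<Theta> (\<lambda>z. f (P z)) = (\<integral>x. f x \<partial>\<mu>)"
      using \<Theta>\<mu>[of "\<lambda>w. f (fst w)"] \<Theta>_PQ[of "\<lambda>w. f (fst w)"] by simp
    then show "integral\<^sup>L \<mu> f = hinner H (\<pi> f \<xi>) \<xi>"
      using gns_vector_state[OF CKP[OF f]] by (simp add: H_def \<pi>_def \<xi>_def)
  qed
  moreover have "measure_representation K \<nu> \<sigma> L \<xi>"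
    unfolding measure_representation_def
  proof (intro conjI ballI)
    show "hilbert_space L" unfolding L_def by (rule hilbert_space_completion[OF X order_refl])
    show "star_representation K L \<sigma>"
      unfolding L_def \<sigma>_def
      by (rule star_representation_mult_op[where P = Q, OF X order_refl QK CK_bdd bdd_mult(1)[OF CKQ]])
    show "\<xi> \<in> hcarrier L" using embed_in_carrier[OF one_X one_X] by (simp add: L_def \<xi>_def)
    fix f assume f: "f \<in> CK K"
    then have "\<Theta> (\<lambda>z. f (Q z)) = (\<integral>x. f x \<partial>\<nu>)"
      using \<Theta>\<nu>[of f] \<Theta>_PQ[of "\<lambda>w. f (snd w)"] by (simp add: CK_def)
    then show "integral\<^sup>L \<nu> f = hinner L (\<sigma> f \<xi>) \<xi>"
      using gns_vector_state[OF CKQ[OF f]] by (simp add: L_def \<sigma>_def \<xi>_def)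
  qed
  moreover have "dilated_by K \<pi> H \<xi> \<sigma> L \<xi>"
    unfolding dilated_by_def
  proof (intro exI[of _ "\<lambda>x. x"] conjI ballI)
    show "hisometry H L (\<lambda>x. x)"
      using compl_carrier_mono[of _ Y] by (auto simp: hisometry_def hlinear_def H_def L_def)
    fix a \<phi> assume a: "a \<in> AK K" and \<phi>: "\<phi> \<in> hcarrier H"
    have aC: "a \<in> CK K" using a by (simp add: AK_def)
    \<comment> \<open>The integrand \<open>d\<close> is affine in the second coordinate because \<open>a\<close> is affine, and \<open>e\<close> does not
      depend on that coordinate; the two agree on the diagonal.\<close>
    have form_eq: "form x (\<lambda>z. a (Q z) * y z) = form x (\<lambda>z. a (P z) * y z)"
      if x: "x \<in> Y" and y: "y \<in> Y" for x y
    proof -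
      obtain g where g: "g \<in> CK K" "\<forall>z\<in>Z. x z = g (P z)" using x by (auto simp: Y_def)
      obtain h where h: "h \<in> CK K" "\<forall>z\<in>Z. y z = h (P z)" using y by (auto simp: Y_def)
      define d where "d = (\<lambda>w. g (fst w) * cnj (a (snd w) * h (fst w)))"
      define e where "e = (\<lambda>w :: 'a \<times> 'a. g (fst w) * cnj (a (fst w) * h (fst w)))"
      have cont1: "continuous_on (K \<times> K) (\<lambda>w. f (fst w))"
        and cont2: "continuous_on (K \<times> K) (\<lambda>w. f (snd w))" if "f \<in> CK K" for f
        by (rule continuous_on_compose2[of K f]; use that in \<open>auto simp: CK_def intro!: continuous_intros\<close>)+
      have d: "continuous_on (K \<times> K) d" "continuous_on (K \<times> K) e"
        unfolding d_def e_def by (intro continuous_intros cont1 cont2 aC g(1) h(1))+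
      have aff_d: "affine_in_snd K d"
        unfolding affine_in_snd_def
      proof (intro ballI)
        fix x y y' and t :: real
        assume "x \<in> K" "y \<in> K" "y' \<in> K" "t \<in> {0..1}"
        then have eq: "a ((1 - t) *\<^sub>R y + t *\<^sub>R y') = (1 - t) *\<^sub>R a y + t *\<^sub>R a y'"
          using a by (simp add: AK_def)
        show "d (x, (1 - t) *\<^sub>R y + t *\<^sub>R y') = (1 - t) *\<^sub>R d (x, y) + t *\<^sub>R d (x, y')"
          unfolding d_def fst_conv snd_conv eq by (simp add: scaleR_conv_of_real algebra_simps)
      qed
      have aff_e: "affine_in_snd K e"
        by (simp add: affine_in_snd_def e_def flip: scaleR_add_left)
      have "form x (\<lambda>z. a (Q z) * y z) = \<Theta> (\<lambda>z. d (P z, Q z))"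
        unfolding form_def
        by (rule \<Theta>_cong[OF form_in_bounded]) (use x y Y(2) bdd_mult(1)[OF CKQ[OF aC]] g h in \<open>auto simp: d_def\<close>)
      also have "\<dots> = (\<integral>x. d (x, x) \<partial>\<mu>)" unfolding \<Theta>_PQ by (rule \<Theta>\<mu>[OF d(1) aff_d])
      also have "\<dots> = (\<integral>x. e (x, x) \<partial>\<mu>)" by (simp add: d_def e_def)
      also have "\<dots> = \<Theta> (\<lambda>z. e (P z, Q z))" unfolding \<Theta>_PQ by (rule \<Theta>\<mu>[OF d(2) aff_e, symmetric])
      also have "\<dots> = form x (\<lambda>z. a (P z) * y z)"
        unfolding form_def
        by (rule \<Theta>_cong[OF form_in_bounded, symmetric])
          (use x y Y(2) bdd_mult(1)[OF CKP[OF aC]] g h in \<open>auto simp: e_def\<close>)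
      finally show ?thesis .
    qed
    have \<phi>: "\<phi> \<in> compl_carrier Y" using \<phi> by (simp add: H_def)
    then obtain q where q: "represents Y q \<phi>" by (auto simp: compl_carrier_def)
    have "hadjoint (hilbert_completion Y) L (\<lambda>x. x) (\<sigma> a \<phi>) = \<pi> a \<phi>"
    proof (rule hadjoint_completion[OF _ Y(1)])
      show "\<pi> a \<phi> \<in> compl_carrier Y"
        unfolding \<pi>_def by (rule mult_op_closed[OF CKP[OF aC] YP[OF aC] \<phi>])
      fix \<psi> assume "\<psi> \<in> compl_carrier Y"
      then obtain p where p: "represents Y p \<psi>" by (auto simp: compl_carrier_def)
      have "(\<lambda>n. form (p n) (\<lambda>z. a (Q z) * q n z)) \<longlonglongrightarrow> compl_inner \<psi> (\<sigma> a \<phi>)"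
        unfolding \<sigma>_def
        by (intro compl_inner_lim[OF p represents_mult_op[OF CKQ[OF aC] represents_X[OF q]]] bdd_mult(1) CKQ[OF aC])
      moreover have "(\<lambda>n. form (p n) (\<lambda>z. a (P z) * q n z)) \<longlonglongrightarrow> compl_inner \<psi> (\<pi> a \<phi>)"
        unfolding \<pi>_def
        by (intro compl_inner_lim[OF p represents_mult_op[OF CKP[OF aC] q]] YP[OF aC])
      ultimately show "hinner L \<psi> (\<sigma> a \<phi>) = compl_inner \<psi> (\<pi> a \<phi>)"
        using form_eq[OF representsD(1)[OF p] representsD(1)[OF q]] LIMSEQ_unique by (simp add: L_def)
    qed
    then show "\<pi> a \<phi> = hadjoint H L (\<lambda>x. x) (\<sigma> a \<phi>)" by (simp add: H_def)
  qed simp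
  ultimately show ?thesis unfolding dilation_le_def by blast
qed

end
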